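(* Let $G$ be a compact Lie group, let $\mathcal{H}$ be a separable infinite dimensional complex Hilbert space, let $\mathcal{C} \subset \mathrm{Irrep}(G)$ be a choice of irreducible representations of $G$, and let $\alpha \in \mathrm{hom}_{\mathrm{st}}(G,U(\mathcal{H}))_{\mathcal{C}}$. Suppose that $\mathcal{C}$ contains the trivial representation. Then the conjugation map $$\pi_\alpha : U(\mathcal{H}) \to \mathrm{hom}_{\mathrm{st}}(G,U(\mathcal{H}))_{\mathcal{C}}, \qquad F \mapsto F\alpha F^{-1},$$ has no sections; that is, there is no continuous map $\sigma : \mathrm{hom}_{\mathrm{st}}(G,U(\mathcal{H}))_{\mathcal{C}} \to U(\mathcal{H})$ with $\pi_\alpha \circ \sigma = \mathrm{id}$.
   Context: $U(\mathcal{H})$ is the group of unitary operators on $\mathcal{H}$ with the strong operator topology. $\mathrm{Irrep}(G)$ is the set of isomorphism classes of irreducible representations of $G$. A continuous homomorphism $\alpha : G \to U(\mathcal{H})$ makes $\mathcal{H}$ a $G$-representation $\mathcal{H}_\alpha$; for $V \in \mathrm{Irrep}(G)$, the isotypical component $\mathcal{H}_\alpha^V$ is the image of the evaluation map $V \otimes \mathrm{hom}_G(V,\mathcal{H}_\alpha) \to \mathcal{H}_\alpha$, $v \otimes f \mapsto f(v)$. $\mathrm{hom}_{\mathrm{st}}(G,U(\mathcal{H}))_{\mathcal{C}}$ is the set of continuous homomorphisms $\alpha : G \to U(\mathcal{H})$ with $\dim \mathcal{H}_\alpha^V = 0$ for $V \notin \mathcal{C}$ and $\dim \mathcal{H}_\alpha^V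 = \infty$ for $V \in \mathcal{C}$, with the subspace topology from the compact-open topology on the space of continuous maps $G \to U(\mathcal{H})$. $F\alpha F^{-1}$ denotes the homomorphism $g \mapsto F\alpha(g)F^{-1}$.
   Formalization: The formal theorem also assumes that C is not just {trivial representation}. If C contains only the trivial representation, hom_st(G,U(H))_C is the single trivial homomorphism and the constant map to the identity is a continuous section, so the claim fails exactly there. *)

theory Defs
  imports "HOL-Analysis.Analysis" "HOL-Algebra.Group" "Jordan_Normal_Form.Matrix"
begin

section \<open>Complex Hilbert spaces\<close>

text \<open>The inner product is linear in its first argument. Positive definiteness is not listed
  separately: it follows from the last axiom and the axioms of a norm.\<close>

class complex_inner = real_normed_vector +
  fixes scaleC :: "complex \<Rightarrow> 'a \<Rightarrow> 'a"  (infixr \<open>*\<^sub>C\<close> 75)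
    and cinner :: "'a \<Rightarrow> 'a \<Rightarrow> complex"
  assumes scaleC_add_right: "c *\<^sub>C (x + y) = c *\<^sub>C x + c *\<^sub>C y"
    and scaleC_add_left: "(c + d) *\<^sub>C x = c *\<^sub>C x + d *\<^sub>C x"
    and scaleC_scaleC: "c *\<^sub>C d *\<^sub>C x = (c * d) *\<^sub>C x"
    and scaleC_of_real: "complex_of_real r *\<^sub>C x = r *\<^sub>R x"
    and cinner_commute: "cinner x y = cnj (cinner y x)"
    and cinner_add_left: "cinner (x + y) z = cinner x z + cinner y z"
    and cinner_scaleC_left: "cinner (c *\<^sub>C x) y = c * cinner x y"
    and norm_eq_sqrt_cinner: "norm x = sqrt (Re (cinner x x))"

class chilbert_space = complex_inner + complete_space

lemma vector_space_scaleC: "Vector_Spaces.vector_space (scaleC :: complex \<Rightarrow> 'a \<Rightarrow> 'a::complex_inner)"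
proof
  fix x :: 'a
  show "1 *\<^sub>C x = x"
    using scaleC_of_real[of 1 x] by simp
qed (simp_all add: scaleC_add_right scaleC_add_left scaleC_scaleC)

global_interpretation complex_vector:
    Vector_Spaces.vector_space "scaleC :: complex \<Rightarrow> 'a \<Rightarrow> 'a::complex_inner"
  by (rule vector_space_scaleC)

text \<open>The library's dimension function is 0 on infinite-dimensional subspaces, so infinite
  dimension is expressed as the absence of a finite spanning set.\<close>

definition infinite_dimensional :: "'h::complex_inner set \<Rightarrow> bool" where
  "infinite_dimensional S \<longleftrightarrow> \<not> (\<exists>B. finite B \<and> S \<subseteq> complex_vector.span B)"

section \<open>The unitary group with the strong operator topology\<close>

text \<open>Elements of the type of bounded linear maps are only real linear, hence the requirement
  of complex homogeneity.\<close>

definition unitaries :: "('h::chilbert_space \<Rightarrow>\<^sub>L 'h) set" where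
  "unitaries = {F. (\<forall>c x. blinfun_apply F (c *\<^sub>C x) = c *\<^sub>C blinfun_apply F x) \<and>
     (\<forall>x y. cinner (blinfun_apply F x) (blinfun_apply F y) = cinner x y) \<and>
     surj (blinfun_apply F)}"

definition unitary_group :: "('h::chilbert_space \<Rightarrow>\<^sub>L 'h) monoid" where
  "unitary_group = \<lparr>carrier = unitaries, mult = (o\<^sub>L), one = id_blinfun\<rparr>"

definition unitary_topology :: "('h::chilbert_space \<Rightarrow>\<^sub>L 'h) topology" where
  "unitary_topology = subtopology strong_operator_topology unitaries"

section \<open>The compact-open topology\<close>

text \<open>Maps are taken extensional, so that two maps agreeing on the space are equal.\<close>

definition continuous_maps :: "'a topology \<Rightarrow> 'b topology \<Rightarrow> ('a \<Rightarrow> 'b) set" where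
  "continuous_maps X Y = {f \<in> extensional (topspace X). continuous_map X Y f}"

definition compact_open_topology :: "'a topology \<Rightarrow> 'b topology \<Rightarrow> ('a \<Rightarrow> 'b) topology" where
  "compact_open_topology X Y = topology_generated_by
     {{f \<in> continuous_maps X Y. f ` K \<subseteq> U} | K U. compactin X K \<and> openin Y U}"

section \<open>Lie groups\<close>

text \<open>Points of n-dimensional Euclidean space are functions on the naturals vanishing from
  index n on, as in the library's topology Euclidean\_space n; the dimension 0 is included, so
  that finite groups are Lie groups. Smoothness means that all iterated partial derivatives
  exist and are continuous.\<close>

definition partial_deriv :: "nat \<Rightarrow> ((nat \<Rightarrow> real) \<Rightarrow> real) \<Rightarrow> (nat \<Rightarrow> real) \<Rightarrow> real" where
  "partial_deriv i f x = deriv (\<lambda>t. f (x(i := t))) (x i)"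

primrec Ck_on :: "nat \<Rightarrow> nat \<Rightarrow> (nat \<Rightarrow> real) set \<Rightarrow> ((nat \<Rightarrow> real) \<Rightarrow> real) \<Rightarrow> bool" where
  "Ck_on n 0 U f \<longleftrightarrow> continuous_map (subtopology (Euclidean_space n) U) euclideanreal f"
| "Ck_on n (Suc k) U f \<longleftrightarrow>
     continuous_map (subtopology (Euclidean_space n) U) euclideanreal f \<and>
     (\<forall>i<n. (\<forall>x\<in>U. (\<lambda>t. f (x(i := t))) differentiable (at (x i))) \<and>
            Ck_on n k U (partial_deriv i f))"

definition smooth_map :: "nat \<Rightarrow> nat \<Rightarrow> (nat \<Rightarrow> real) set \<Rightarrow> ((nat \<Rightarrow> real) \<Rightarrow> (nat \<Rightarrow> real)) \<Rightarrow> bool" where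
  "smooth_map m n U F \<longleftrightarrow> openin (Euclidean_space m) U \<and>
     (\<forall>j<n. \<forall>k. Ck_on m k U (\<lambda>x. F x j))"

type_synonym 'a chart = "'a set \<times> ('a \<Rightarrow> (nat \<Rightarrow> real))"

definition is_chart :: "'a topology \<Rightarrow> nat \<Rightarrow> 'a chart \<Rightarrow> bool" where
  "is_chart T n = (\<lambda>(U, \<phi>). openin T U \<and> openin (Euclidean_space n) (\<phi> ` U) \<and>
     homeomorphic_map (subtopology T U) (subtopology (Euclidean_space n) (\<phi> ` U)) \<phi>)"

definition smooth_atlas :: "'a topology \<Rightarrow> nat \<Rightarrow> 'a chart set \<Rightarrow> bool" where
  "smooth_atlas T n \<A> \<longleftrightarrow>
     (\<forall>c\<in>\<A>. is_chart T n c) \<and> (\<Union>c\<in>\<A>. fst c) = topspace T \<and>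
     (\<forall>(U, \<phi>)\<in>\<A>. \<forall>(V, \<psi>)\<in>\<A>. smooth_map n n (\<phi> ` (U \<inter> V)) (\<lambda>x. \<psi> (inv_into U \<phi> x)))"

text \<open>The identification of 2n-dimensional space with pairs of points of n-dimensional space.\<close>

definition first_half :: "nat \<Rightarrow> (nat \<Rightarrow> real) \<Rightarrow> (nat \<Rightarrow> real)" where
  "first_half n z = (\<lambda>i. if i < n then z i else 0)"

definition second_half :: "nat \<Rightarrow> (nat \<Rightarrow> real) \<Rightarrow> (nat \<Rightarrow> real)" where
  "second_half n z = (\<lambda>i. if i < n then z (n + i) else 0)"

definition lie_group :: "'g monoid \<Rightarrow> 'g topology \<Rightarrow> nat \<Rightarrow> 'g chart set \<Rightarrow> bool" where
  "lie_group G T n \<A> \<longleftrightarrow>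
     Group.group G \<and> topspace T = carrier G \<and>
     Hausdorff_space T \<and> second_countable T \<and> smooth_atlas T n \<A> \<and>
     continuous_map (prod_topology T T) T (\<lambda>(x, y). x \<otimes>\<^bsub>G\<^esub> y) \<and>
     continuous_map T T (m_inv G) \<and>
     (\<forall>(U, \<phi>)\<in>\<A>. \<forall>(V, \<psi>)\<in>\<A>. \<forall>(W, \<theta>)\<in>\<A>.
        smooth_map (2 * n) n
          {z \<in> topspace (Euclidean_space (2 * n)).
             first_half n z \<in> \<phi> ` U \<and> second_half n z \<in> \<psi> ` V \<and>
             inv_into U \<phi> (first_half n z) \<otimes>\<^bsub>G\<^esub> inv_into V \<psi> (second_half n z) \<in> W}
          (\<lambda>z. \<theta> (inv_into U \<phi> (first_half n z) \<otimes>\<^bsub>G\<^esub> inv_into V \<psi> (second_half n z)))) \<and>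
     (\<forall>(U, \<phi>)\<in>\<A>. \<forall>(V, \<psi>)\<in>\<A>.
        smooth_map n n (\<phi> ` {x \<in> U. inv\<^bsub>G\<^esub> x \<in> V}) (\<lambda>x. \<psi> (inv\<^bsub>G\<^esub> (inv_into U \<phi> x))))"

section \<open>Irreducible representations\<close>

text \<open>Irreducible representations of a compact group are finite-dimensional, and choosing a basis
  turns them into continuous homomorphisms to invertible complex matrices. A representation is
  the pair of its dimension and this homomorphism.\<close>

type_synonym 'g matrix_rep = "nat \<times> ('g \<Rightarrow> complex mat)"

definition is_rep :: "'g monoid \<Rightarrow> 'g topology \<Rightarrow> 'g matrix_rep \<Rightarrow> bool" where
  "is_rep G T = (\<lambda>(n, \<rho>).
     (\<forall>g\<in>carrier G. \<rho> g \<in> carrier_mat n n) \<and>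
     \<rho> \<one>\<^bsub>G\<^esub> = 1\<^sub>m n \<and>
     (\<forall>g\<in>carrier G. \<forall>h\<in>carrier G. \<rho> (g \<otimes>\<^bsub>G\<^esub> h) = \<rho> g * \<rho> h) \<and>
     (\<forall>i<n. \<forall>j<n. continuous_map T euclidean (\<lambda>g. \<rho> g $$ (i, j))))"

definition invariant_subspace :: "'g monoid \<Rightarrow> 'g matrix_rep \<Rightarrow> complex vec set \<Rightarrow> bool" where
  "invariant_subspace G = (\<lambda>(n, \<rho>) W. W \<subseteq> carrier_vec n \<and> 0\<^sub>v n \<in> W \<and>
     (\<forall>v\<in>W. \<forall>w\<in>W. v + w \<in> W) \<and> (\<forall>c. \<forall>v\<in>W. c \<cdot>\<^sub>v v \<in> W) \<and>
     (\<forall>g\<in>carrier G. \<forall>v\<in>W. \<rho> g *\<^sub>v v \<in> W))"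

definition is_irrep :: "'g monoid \<Rightarrow> 'g topology \<Rightarrow> 'g matrix_rep \<Rightarrow> bool" where
  "is_irrep G T V \<longleftrightarrow> is_rep G T V \<and> fst V \<noteq> 0 \<and>
     (\<forall>W. invariant_subspace G V W \<longrightarrow> W = {0\<^sub>v (fst V)} \<or> W = carrier_vec (fst V))"

definition isomorphic_reps :: "'g monoid \<Rightarrow> 'g matrix_rep \<Rightarrow> 'g matrix_rep \<Rightarrow> bool" where
  "isomorphic_reps G = (\<lambda>(n, \<rho>) (m, \<rho>'). n = m \<and>
     (\<exists>P\<in>carrier_mat n n. invertible_mat P \<and> (\<forall>g\<in>carrier G. P * \<rho> g = \<rho>' g * P)))"

definition irrep_iso :: "'g monoid \<Rightarrow> 'g topology \<Rightarrow> ('g matrix_rep \<times> 'g matrix_rep) set" where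
  "irrep_iso G T = {(V, W). is_irrep G T V \<and> is_irrep G T W \<and> isomorphic_reps G V W}"

definition irrep_class :: "'g monoid \<Rightarrow> 'g topology \<Rightarrow> 'g matrix_rep \<Rightarrow> 'g matrix_rep set" where
  "irrep_class G T V = irrep_iso G T `` {V}"

definition Irrep :: "'g monoid \<Rightarrow> 'g topology \<Rightarrow> 'g matrix_rep set set" where
  "Irrep G T = {V. is_irrep G T V} // irrep_iso G T"

definition trivial_rep :: "'g matrix_rep" where
  "trivial_rep = (1, \<lambda>_. 1\<^sub>m 1)"

section \<open>Isotypical components and the space of homomorphisms\<close>

definition hom_G ::
    "'g monoid \<Rightarrow> 'g matrix_rep \<Rightarrow> ('g \<Rightarrow> 'h::chilbert_space \<Rightarrow>\<^sub>L 'h) \<Rightarrow> (complex vec \<Rightarrow> 'h) set" where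
  "hom_G G = (\<lambda>(n, \<rho>) \<alpha>. {f.
     (\<forall>v\<in>carrier_vec n. \<forall>w\<in>carrier_vec n. f (v + w) = f v + f w) \<and>
     (\<forall>c. \<forall>v\<in>carrier_vec n. f (c \<cdot>\<^sub>v v) = c *\<^sub>C f v) \<and>
     (\<forall>g\<in>carrier G. \<forall>v\<in>carrier_vec n. f (\<rho> g *\<^sub>v v) = blinfun_apply (\<alpha> g) (f v))})"

text \<open>The image of the evaluation map on the tensor product is the span of the images of the
  elementary tensors.\<close>

definition isotypical ::
    "'g monoid \<Rightarrow> 'g matrix_rep \<Rightarrow> ('g \<Rightarrow> 'h::chilbert_space \<Rightarrow>\<^sub>L 'h) \<Rightarrow> 'h set" where
  "isotypical G V \<alpha> = complex_vector.span {f v | f v. f \<in> hom_G G V \<alpha> \<and> v \<in> carrier_vec (fst V)}"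

definition hom_st ::
    "'g monoid \<Rightarrow> 'g topology \<Rightarrow> 'g matrix_rep set set \<Rightarrow> ('g \<Rightarrow> 'h::chilbert_space \<Rightarrow>\<^sub>L 'h) set" where
  "hom_st G T \<C> = {\<alpha> \<in> continuous_maps T unitary_topology.
     \<alpha> \<in> hom G unitary_group \<and>
     (\<forall>V. is_irrep G T V \<longrightarrow>
        (if irrep_class G T V \<in> \<C> then infinite_dimensional (isotypical G V \<alpha>)
         else isotypical G V \<alpha> = {0}))}"

definition hom_st_topology ::
    "'g monoid \<Rightarrow> 'g topology \<Rightarrow> 'g matrix_rep set set \<Rightarrow> ('g \<Rightarrow> 'h::chilbert_space \<Rightarrow>\<^sub>L 'h) topology" where
  "hom_st_topology G T \<C> = subtopology (compact_open_topology T unitary_topology) (hom_st G T \<C>)"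

definition conjugation ::
    "'g monoid \<Rightarrow> ('g \<Rightarrow> 'h::chilbert_space \<Rightarrow>\<^sub>L 'h) \<Rightarrow> ('h \<Rightarrow>\<^sub>L 'h) \<Rightarrow> ('g \<Rightarrow> 'h \<Rightarrow>\<^sub>L 'h)" where
  "conjugation G \<alpha> F =
     (\<lambda>g\<in>carrier G. F \<otimes>\<^bsub>unitary_group\<^esub> \<alpha> g \<otimes>\<^bsub>unitary_group\<^esub> inv\<^bsub>unitary_group\<^esub> F)"

end

(*
  Put H = the fixed vectors of alpha. Both H and its orthogonal complement are infinite-dimensional,
  the latter because it contains the isotypical components of the nontrivial elements of C.
  Let X be the unit ball of l2 with the weak topology, which is compact. Over X there is the
  Dixmier-Douady field: the Hilbert spaces spanned by vectors z_0, z_1, ... with inner products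
  <z_i(x), z_j(x)> = delta_ij - conj(x_i) x_j. By Brouwer's theorem every continuous section of it
  vanishes somewhere. The sum of this field with a trivial field of infinite rank is trivial
  (Gram-Schmidt), which gives unitaries U_x carrying H onto the fibre at x such that
  beta_x = U_x alpha U_x^(-1) is continuous in x, although U_x itself need not be. If sigma were a section of
  pi_alpha and u a unit vector of H, then sigma(beta_x) u would be a section of the field without
  zeros, since it is fixed by beta_x.
*)

theory Submission
  imports Defs "HOL-Homology.Homology"
begin

section \<open>Orthonormal sequences\<close>

text \<open>\<open>U\<close> cannot be strongly continuous: for a unit vector u of H, sending x to
  \<open>U x\<close> applied to u would already be a section without zeros. The identification of H
  with the fibre at x is therefore made separately for each x, and only inner products are
  controlled. This does not spoil beta_x, because alpha is the identity on H: other vectors of H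
  with the same Gram matrix give the same matrix coefficients of alpha between the generating
  vectors. The base has to be infinite-dimensional, since over a compact metrizable space of finite
  dimension every continuous field of separable infinite-dimensional Hilbert spaces is trivial.
  Brouwer's theorem enters through finite combinations. If t is the sum of the |x_i|^2 over i < M,
  then the sum of the x_i z_i(x) over i < M has squared norm t - t^2, so it vanishes when t = 1; and
  a continuous coefficient field on the ball of C^M without zeros is a multiple of x at some such
  x.\<close>

lemma scaleR_scaleC: "r *\<^sub>R (x::'a::complex_inner) = complex_of_real r *\<^sub>C x"
  by (rule scaleC_of_real [symmetric])

lemma cinner_add_right: "cinner (x::'a::complex_inner) (y + z) = cinner x y + cinner x z"
  by (metis cinner_add_left cinner_commute complex_cnj_add)

lemma cinner_scaleC_right: "cinner (x::'a::complex_inner) (c *\<^sub>C y) = cnj c * cinner x y"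
  by (metis cinner_scaleC_left cinner_commute complex_cnj_mult)

lemma cinner_zero_left [simp]: "cinner 0 (x::'a::complex_inner) = 0"
  using cinner_scaleC_left[of 0 x x] by simp

lemma cinner_zero_right [simp]: "cinner (x::'a::complex_inner) 0 = 0"
  using cinner_scaleC_right[of x 0 x] by simp

lemma cinner_minus_left: "cinner (- (x::'a::complex_inner)) y = - cinner x y"
  using cinner_add_left[of x "- x" y] by (simp add: eq_neg_iff_add_eq_0 add.commute)

lemma cinner_minus_right: "cinner (x::'a::complex_inner) (- y) = - cinner x y"
  using cinner_add_right[of x y "- y"] by (simp add: eq_neg_iff_add_eq_0 add.commute)

lemma cinner_diff_left: "cinner (x - (y::'a::complex_inner)) z = cinner x z - cinner y z"
  using cinner_add_left[of x "- y" z] by (simp add: cinner_minus_left)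

lemma cinner_diff_right: "cinner (x::'a::complex_inner) (y - z) = cinner x y - cinner x z"
  using cinner_add_right[of x y "- z"] by (simp add: cinner_minus_right)

lemma cinner_sum_left: "cinner (sum f A) (x::'a::complex_inner) = (\<Sum>i\<in>A. cinner (f i) x)"
  by (induction A rule: infinite_finite_induct) (auto simp: cinner_add_left)

lemma cinner_sum_right: "cinner (x::'a::complex_inner) (sum f A) = (\<Sum>i\<in>A. cinner x (f i))"
  by (induction A rule: infinite_finite_induct) (auto simp: cinner_add_right)

lemmas cinner_simps = cinner_add_left cinner_add_right cinner_diff_left cinner_diff_right
  cinner_scaleC_left cinner_scaleC_right cinner_minus_left cinner_minus_right

lemma mult_cnj_cmod: "z * cnj z = (complex_of_real (cmod z))\<^sup>2" "cnj z * z = (complex_of_real (cmod z))\<^sup>2"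
  using complex_norm_square[of z] by (simp_all add: mult.commute)

lemma cinner_self: "cinner x (x::'a::complex_inner) = complex_of_real ((norm x)\<^sup>2)"
proof -
  have im: "Im (cinner x x) = 0"
    using arg_cong[where f = Im, OF cinner_commute[of x x]] by simp
  have "Re (cinner x x) \<ge> 0"
    using norm_ge_zero[of x] unfolding norm_eq_sqrt_cinner by simp
  then have "(norm x)\<^sup>2 = Re (cinner x x)" by (simp add: norm_eq_sqrt_cinner)
  with im show ?thesis by (simp add: complex_eq_iff)
qed

lemma norm_scaleC [simp]: "norm (c *\<^sub>C (x::'a::complex_inner)) = cmod c * norm x"
proof -
  have "complex_of_real ((norm (c *\<^sub>C x))\<^sup>2) = (c * cnj c) * complex_of_real ((norm x)\<^sup>2)"
    unfolding cinner_self[symmetric] by (simp add: cinner_simps)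
  also have "\<dots> = complex_of_real ((cmod c * norm x)\<^sup>2)"
    by (simp add: mult_cnj_cmod power_mult_distrib)
  finally have "(norm (c *\<^sub>C x))\<^sup>2 = (cmod c * norm x)\<^sup>2" using of_real_eq_iff by blast
  then show ?thesis by (simp add: power2_eq_iff_nonneg)
qed

lemma norm_diff_square:
  "(norm (x - (y::'a::complex_inner)))\<^sup>2 = (norm x)\<^sup>2 - 2 * Re (cinner x y) + (norm y)\<^sup>2"
proof -
  have "complex_of_real ((norm (x - y))\<^sup>2) = cinner x x - cinner x y - cinner y x + cinner y y"
    unfolding cinner_self[symmetric] by (simp add: cinner_simps)
  also have "Re \<dots> = (norm x)\<^sup>2 - 2 * Re (cinner x y) + (norm y)\<^sup>2"
    using cinner_commute[of y x] by (simp add: cinner_self)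
  finally show ?thesis by simp
qed

lemma cauchy_schwarz: "cmod (cinner x (y::'a::complex_inner)) \<le> norm x * norm y"
proof (cases "y = 0")
  case False
  let ?c = "cinner x y / complex_of_real ((norm y)\<^sup>2)"
  have "0 \<le> (norm (x - ?c *\<^sub>C y))\<^sup>2" by simp
  also have "\<dots> = (norm x)\<^sup>2 - (cmod (cinner x y))\<^sup>2 / (norm y)\<^sup>2"
  proof -
    have "cinner x (?c *\<^sub>C y) = complex_of_real ((cmod (cinner x y))\<^sup>2 / (norm y)\<^sup>2)"
      by (simp add: cinner_simps mult_cnj_cmod)
    moreover have "(norm (?c *\<^sub>C y))\<^sup>2 = (cmod (cinner x y))\<^sup>2 / (norm y)\<^sup>2"
      using False by (simp add: norm_divide norm_power power_mult_distrib power_divide field_simps)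
    ultimately show ?thesis by (simp add: norm_diff_square del: norm_scaleC)
  qed
  finally have "(cmod (cinner x y))\<^sup>2 \<le> (norm x * norm y)\<^sup>2"
    using False by (simp add: field_simps power_mult_distrib)
  then show ?thesis by (rule power2_le_imp_le) simp
qed auto

lemma tendsto_cinner:
  fixes f g :: "'b \<Rightarrow> 'a::complex_inner"
  assumes f: "(f \<longlongrightarrow> a) F" and g: "(g \<longlongrightarrow> b) F"
  shows "((\<lambda>x. cinner (f x) (g x)) \<longlongrightarrow> cinner a b) F"
proof -
  have 1: "((\<lambda>x. norm (f x - a) * norm (g x) + norm a * norm (g x - b)) \<longlongrightarrow> norm (a - a) * norm b + norm a * norm (b - b)) F"
    by (intro tendsto_intros f g)
  have "((\<lambda>x. cinner (f x) (g x) - cinner a b) \<longlongrightarrow> 0) F"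
  proof (rule Lim_null_comparison)
    show "\<forall>\<^sub>F x in F. norm (cinner (f x) (g x) - cinner a b)
        \<le> norm (f x - a) * norm (g x) + norm a * norm (g x - b)"
    proof (rule always_eventually, rule allI)
      fix x
      have "cinner (f x) (g x) - cinner a b = cinner (f x - a) (g x) + cinner a (g x - b)"
        by (simp add: cinner_simps)
      then show "norm (cinner (f x) (g x) - cinner a b)
          \<le> norm (f x - a) * norm (g x) + norm a * norm (g x - b)"
        using norm_triangle_ineq[of "cinner (f x - a) (g x)" "cinner a (g x - b)"]
          cauchy_schwarz[of "f x - a" "g x"] cauchy_schwarz[of a "g x - b"] by simp
    qed
  qed (use 1 in simp)
  then show ?thesis by (rule LIM_zero_cancel)
qed

lemma continuous_on_cinner_left: "continuous_on A (\<lambda>v. cinner v (w::'a::complex_inner))"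
  unfolding continuous_on_def by (intro ballI tendsto_cinner tendsto_const tendsto_ident_at)

lemma tendsto_scaleC:
  fixes f :: "'b \<Rightarrow> 'a::complex_inner"
  assumes c: "(c \<longlongrightarrow> l) F" and f: "(f \<longlongrightarrow> a) F"
  shows "((\<lambda>x. c x *\<^sub>C f x) \<longlongrightarrow> l *\<^sub>C a) F"
proof -
  have 1: "((\<lambda>x. cmod (c x - l) * norm (f x) + cmod l * norm (f x - a)) \<longlongrightarrow> cmod (l - l) * norm a + cmod l * norm (a - a)) F"
    by (intro tendsto_intros c f)
  have "((\<lambda>x. c x *\<^sub>C f x - l *\<^sub>C a) \<longlongrightarrow> 0) F"
  proof (rule Lim_null_comparison)
    show "\<forall>\<^sub>F x in F. norm (c x *\<^sub>C f x - l *\<^sub>C a)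
        \<le> cmod (c x - l) * norm (f x) + cmod l * norm (f x - a)"
    proof (rule always_eventually, rule allI)
      fix x
      have "c x *\<^sub>C f x - l *\<^sub>C a = (c x - l) *\<^sub>C f x + l *\<^sub>C (f x - a)"
        by (simp add: complex_vector.scale_left_diff_distrib complex_vector.scale_right_diff_distrib)
      then show "norm (c x *\<^sub>C f x - l *\<^sub>C a)
          \<le> cmod (c x - l) * norm (f x) + cmod l * norm (f x - a)"
        using norm_triangle_ineq[of "(c x - l) *\<^sub>C f x" "l *\<^sub>C (f x - a)"] by simp
    qed
  qed (use 1 in simp)
  then show ?thesis by (rule LIM_zero_cancel)
qed

section \<open>Bessel's inequality and orthonormal series\<close>

definition orthonormal :: "(nat \<Rightarrow> 'a::complex_inner) \<Rightarrow> bool" where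
  "orthonormal e \<longleftrightarrow> (\<forall>i j. cinner (e i) (e j) = (if i = j then 1 else 0))"

lemma orthonormalD: "orthonormal e \<Longrightarrow> cinner (e i) (e j) = (if i = j then 1 else 0)"
  by (simp add: orthonormal_def)

lemma orthonormal_norm: "orthonormal e \<Longrightarrow> norm (e i) = 1"
  using orthonormalD[of e i i] by (simp add: norm_eq_sqrt_cinner)

lemma orthonormal_cinner_sum:
  assumes "orthonormal e" "finite A"
  shows "cinner (\<Sum>i\<in>A. a i *\<^sub>C e i) (e j) = (if j \<in> A then a j else 0)"
  using assms by (simp add: cinner_sum_left cinner_simps orthonormalD if_distrib cong: if_cong)

lemma orthonormal_norm_sum:
  assumes "orthonormal e" "finite A"
  shows "(norm (\<Sum>i\<in>A. a i *\<^sub>C e i))\<^sup>2 = (\<Sum>i\<in>A. (cmod (a i))\<^sup>2)"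
proof -
  have "complex_of_real ((norm (\<Sum>i\<in>A. a i *\<^sub>C e i))\<^sup>2) = (\<Sum>j\<in>A. cnj (a j) * a j)"
    unfolding cinner_self[symmetric]
    by (subst cinner_sum_right) (simp add: cinner_simps orthonormal_cinner_sum assms)
  also have "\<dots> = complex_of_real (\<Sum>i\<in>A. (cmod (a i))\<^sup>2)"
    by (simp add: mult_cnj_cmod)
  finally show ?thesis using of_real_eq_iff by blast
qed

lemma bessel:
  assumes "orthonormal e" "finite A"
  shows "(\<Sum>i\<in>A. (cmod (cinner v (e i)))\<^sup>2) = (norm v)\<^sup>2 - (norm (v - (\<Sum>i\<in>A. cinner v (e i) *\<^sub>C e i)))\<^sup>2"
proof -
  let ?p = "\<Sum>i\<in>A. cinner v (e i) *\<^sub>C e i"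
  have "cinner v ?p = complex_of_real (\<Sum>i\<in>A. (cmod (cinner v (e i)))\<^sup>2)"
    by (simp add: cinner_sum_right cinner_simps mult_cnj_cmod)
  then show ?thesis
    by (simp add: norm_diff_square orthonormal_norm_sum[OF assms])
qed

lemma bessel_le:
  assumes "orthonormal e" "finite A"
  shows "(\<Sum>i\<in>A. (cmod (cinner v (e i)))\<^sup>2) \<le> (norm v)\<^sup>2"
  unfolding bessel[OF assms] by simp

text \<open>The squared norm of a block of terms is a block of the convergent series of squares, so
  the partial sums are Cauchy. The hypothesis bounds finite sums, which is the form supplied by
  \<open>bessel_le\<close> and by \<open>l2_ball\<close>.\<close>

lemma orthonormal_summable:
  fixes e :: "nat \<Rightarrow> 'a::chilbert_space"
  assumes e: "orthonormal e" and bd: "\<And>n. (\<Sum>i<n. (cmod (a i))\<^sup>2) \<le> B"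
  shows "summable (\<lambda>i. a i *\<^sub>C e i)"
proof -
  have s: "summable (\<lambda>i. (cmod (a i))\<^sup>2)"
    using bd by (intro bounded_imp_summable[where B = B]) (auto simp: lessThan_Suc_atMost[symmetric] simp del: sum.lessThan_Suc)
  have "Cauchy (\<lambda>n. \<Sum>i<n. a i *\<^sub>C e i)"
  proof (rule CauchyI)
    fix r :: real assume r: "r > 0"
    from s[unfolded summable_Cauchy, rule_format, of "r\<^sup>2"] r obtain N
      where N: "\<And>m n. m \<ge> N \<Longrightarrow> norm (\<Sum>i\<in>{m..<n}. (cmod (a i))\<^sup>2) < r\<^sup>2" by auto
    have *: "norm ((\<Sum>i<n. a i *\<^sub>C e i) - (\<Sum>i<m. a i *\<^sub>C e i)) < r" if "m \<ge> N" "m \<le> n" for m n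
    proof -
      have 1: "(\<Sum>i<n. a i *\<^sub>C e i) - (\<Sum>i<m. a i *\<^sub>C e i) = (\<Sum>i\<in>{m..<n}. a i *\<^sub>C e i)"
        using that(2) sum_diff_nat_ivl[of 0 m n "\<lambda>i. a i *\<^sub>C e i"] by (simp add: atLeast0LessThan)
      have 2: "(norm (\<Sum>i\<in>{m..<n}. a i *\<^sub>C e i))\<^sup>2 < r\<^sup>2"
        using N[OF that(1), of n] by (simp add: orthonormal_norm_sum[OF e] sum_nonneg)
      show ?thesis unfolding 1 using power_less_imp_less_base[OF 2] r by simp
    qed
    show "\<exists>M. \<forall>m\<ge>M. \<forall>n\<ge>M. norm ((\<Sum>i<m. a i *\<^sub>C e i) - (\<Sum>i<n. a i *\<^sub>C e i)) < r"
    proof (intro exI[of _ N] allI impI)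
      fix m n assume "m \<ge> N" "n \<ge> N"
      then show "norm ((\<Sum>i<m. a i *\<^sub>C e i) - (\<Sum>i<n. a i *\<^sub>C e i)) < r"
        using *[of m n] *[of n m] by (cases "m \<le> n") (simp_all add: norm_minus_commute)
    qed
  qed
  then show ?thesis by (simp add: summable_iff_convergent Cauchy_convergent_iff)
qed

lemma orthonormal_coeff_suminf:
  fixes e :: "nat \<Rightarrow> 'a::chilbert_space"
  assumes e: "orthonormal e" and bd: "\<And>n. (\<Sum>i<n. (cmod (a i))\<^sup>2) \<le> B"
  shows "cinner (suminf (\<lambda>i. a i *\<^sub>C e i)) (e j) = a j"
proof -
  have "(\<lambda>n. \<Sum>i<n. a i *\<^sub>C e i) \<longlonglongrightarrow> suminf (\<lambda>i. a i *\<^sub>C e i)"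
    by (rule summable_LIMSEQ[OF orthonormal_summable[OF assms]])
  then have "(\<lambda>n. cinner (\<Sum>i<n. a i *\<^sub>C e i) (e j)) \<longlonglongrightarrow> cinner (suminf (\<lambda>i. a i *\<^sub>C e i)) (e j)"
    by (intro tendsto_cinner tendsto_const)
  moreover have "(\<lambda>n. cinner (\<Sum>i<n. a i *\<^sub>C e i) (e j)) \<longlonglongrightarrow> a j"
    by (rule tendsto_eventually) (auto simp: orthonormal_cinner_sum[OF e] eventually_sequentially intro!: exI[of _ "Suc j"])
  ultimately show ?thesis by (rule LIMSEQ_unique)
qed

lemma norm_suminf_orthonormal_le:
  fixes e :: "nat \<Rightarrow> 'a::chilbert_space"
  assumes e: "orthonormal e" and bd: "\<And>n. (\<Sum>i<n. (cmod (a i))\<^sup>2) \<le> B\<^sup>2" and "B \<ge> 0"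
  shows "norm (suminf (\<lambda>i. a i *\<^sub>C e i)) \<le> B"
proof (rule LIMSEQ_le_const2)
  show "(\<lambda>n. norm (\<Sum>i<n. a i *\<^sub>C e i)) \<longlonglongrightarrow> norm (suminf (\<lambda>i. a i *\<^sub>C e i))"
    by (intro tendsto_norm summable_LIMSEQ orthonormal_summable[OF e bd])
  show "\<exists>N. \<forall>n\<ge>N. norm (\<Sum>i<n. a i *\<^sub>C e i) \<le> B"
  proof (intro exI[of _ 0] allI impI)
    fix n
    have "(norm (\<Sum>i<n. a i *\<^sub>C e i))\<^sup>2 \<le> B\<^sup>2"
      unfolding orthonormal_norm_sum[OF e finite_lessThan] by (rule bd)
    then show "norm (\<Sum>i<n. a i *\<^sub>C e i) \<le> B" by (rule power2_le_imp_le) (rule \<open>B \<ge> 0\<close>)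
  qed
qed

section \<open>Closed subspaces and orthonormal bases\<close>

definition closed_subspace :: "'a::complex_inner set \<Rightarrow> bool" where
  "closed_subspace S \<longleftrightarrow> complex_vector.subspace S \<and> closed S"

lemma closed_subspace_suminf:
  assumes S: "closed_subspace S" and "\<And>i. f i \<in> S" "summable f"
  shows "suminf f \<in> S"
proof (rule Lim_in_closed_set)
  show "closed S" using S by (simp add: closed_subspace_def)
  show "(\<lambda>n. \<Sum>i<n. f i) \<longlonglongrightarrow> suminf f" using assms by (intro summable_LIMSEQ)
  show "\<forall>\<^sub>F n in sequentially. (\<Sum>i<n. f i) \<in> S"
    using S assms(2) by (intro always_eventually allI complex_vector.subspace_sum) (auto simp: closed_subspace_def)
qed auto

lemma closed_subspace_UNIV: "closed_subspace UNIV"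
  by (simp add: closed_subspace_def)

lemma closed_subspace_closure_span: "closed_subspace (closure (complex_vector.span B))"
proof -
  have "complex_vector.subspace (closure (complex_vector.span B))"
    unfolding complex_vector.subspace_def
  proof (intro conjI ballI allI)
    show "0 \<in> closure (complex_vector.span B)"
      using closure_subset complex_vector.span_zero by blast
  next
    fix x y assume "x \<in> closure (complex_vector.span B)" "y \<in> closure (complex_vector.span B)"
    then obtain f g where "\<And>n. f n \<in> complex_vector.span B" "f \<longlonglongrightarrow> x" "\<And>n. g n \<in> complex_vector.span B" "g \<longlonglongrightarrow> y"
      unfolding closure_sequential by blast
    then show "x + y \<in> closure (complex_vector.span B)"
      unfolding closure_sequential
      by (intro exI[of _ "\<lambda>n. f n + g n"]) (auto intro: tendsto_add complex_vector.span_add)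
  next
    fix c x assume "x \<in> closure (complex_vector.span B)"
    then obtain f where "\<And>n. f n \<in> complex_vector.span B" "f \<longlonglongrightarrow> x"
      unfolding closure_sequential by blast
    then show "c *\<^sub>C x \<in> closure (complex_vector.span B)"
      unfolding closure_sequential
      by (intro exI[of _ "\<lambda>n. c *\<^sub>C f n"]) (auto intro: tendsto_scaleC complex_vector.span_scale)
  qed
  then show ?thesis by (simp add: closed_subspace_def)
qed

text \<open>Totality is put as the absence of a nonzero vector of S orthogonal to the sequence.
  Maximality under inclusion yields it in this form, and for closed S it implies the expansion in
  \<open>parseval_tendsto\<close>.\<close>

definition orthonormal_basis :: "(nat \<Rightarrow> 'a::complex_inner) \<Rightarrow> 'a set \<Rightarrow> bool" where
  "orthonormal_basis e S \<longleftrightarrow> orthonormal e \<and> range e \<subseteq> S \<and>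
     (\<forall>v\<in>S. (\<forall>i. cinner v (e i) = 0) \<longrightarrow> v = 0)"

lemma orthonormal_basisD:
  assumes "orthonormal_basis e S"
  shows "orthonormal e" "e i \<in> S" "v \<in> S \<Longrightarrow> (\<And>i. cinner v (e i) = 0) \<Longrightarrow> v = 0"
  using assms by (auto simp: orthonormal_basis_def)

text \<open>For orthonormal \<open>e\<close> and \<open>f\<close>, the partial isometry that carries
  \<open>e i\<close> to \<open>f i\<close> and kills the orthogonal complement of \<open>e\<close>.
  It is defined on the whole space, so its linearity needs no membership conditions.\<close>

definition basis_map :: "(nat \<Rightarrow> 'a) \<Rightarrow> (nat \<Rightarrow> 'a) \<Rightarrow> 'a \<Rightarrow> 'a::chilbert_space" where
  "basis_map e f v = suminf (\<lambda>i. cinner v (e i) *\<^sub>C f i)"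

lemma cinner_basis_map:
  assumes "orthonormal e" "orthonormal f"
  shows "cinner (basis_map e f v) (f j) = cinner v (e j)"
  unfolding basis_map_def by (intro orthonormal_coeff_suminf[OF assms(2) bessel_le[OF assms(1) finite_lessThan]])

lemma basis_map_summable:
  assumes "orthonormal e" "orthonormal (f :: nat \<Rightarrow> 'a::chilbert_space)"
  shows "summable (\<lambda>i. cinner v (e i) *\<^sub>C f i)"
  by (rule orthonormal_summable[OF assms(2) bessel_le[OF assms(1) finite_lessThan]])

lemma norm_basis_map_le:
  assumes "orthonormal e" "orthonormal f"
  shows "norm (basis_map e f v) \<le> norm v"
  unfolding basis_map_def
  by (rule norm_suminf_orthonormal_le[OF assms(2) bessel_le[OF assms(1) finite_lessThan]]) simp

lemma basis_map_in:
  assumes "orthonormal e" "orthonormal f" "closed_subspace S" "range f \<subseteq> S"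
  shows "basis_map e f v \<in> S"
  unfolding basis_map_def using assms
  by (intro closed_subspace_suminf basis_map_summable) (auto simp: closed_subspace_def intro!: complex_vector.subspace_scale)

lemma basis_map_add:
  assumes "orthonormal e" "orthonormal f"
  shows "basis_map e f (v + w) = basis_map e f v + basis_map e f w"
  unfolding basis_map_def
  by (simp add: suminf_add basis_map_summable[OF assms] cinner_simps scaleC_add_left)

lemma basis_map_scaleC:
  assumes "orthonormal e" "orthonormal f"
  shows "basis_map e f (c *\<^sub>C v) = c *\<^sub>C basis_map e f v"
proof -
  have "(\<lambda>n. c *\<^sub>C (\<Sum>i<n. cinner v (e i) *\<^sub>C f i)) \<longlonglongrightarrow> c *\<^sub>C basis_map e f v"
    unfolding basis_map_def by (intro tendsto_scaleC tendsto_const summable_LIMSEQ basis_map_summable assms)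
  then have "(\<lambda>i. cinner (c *\<^sub>C v) (e i) *\<^sub>C f i) sums (c *\<^sub>C basis_map e f v)"
    by (simp add: sums_def complex_vector.scale_sum_right cinner_simps scaleC_scaleC)
  then show ?thesis unfolding basis_map_def by (simp add: sums_iff)
qed

text \<open>The difference of the two sides lies in S and is orthogonal to every
  \<open>e i\<close>.\<close>

lemma basis_map_self:
  assumes e: "orthonormal_basis e S" and S: "closed_subspace S" and v: "v \<in> S"
  shows "basis_map e e v = v"
proof -
  note o = orthonormal_basisD(1)[OF e]
  have "basis_map e e v \<in> S" by (rule basis_map_in[OF o o S]) (use e in \<open>auto simp: orthonormal_basis_def\<close>)
  then have "v - basis_map e e v \<in> S"
    using v S by (auto simp: closed_subspace_def complex_vector.subspace_diff)
  then have "v - basis_map e e v = 0"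
    by (rule orthonormal_basisD(3)[OF e]) (simp add: cinner_simps cinner_basis_map[OF o o])
  then show ?thesis by simp
qed

lemma basis_map_inverse:
  assumes e: "orthonormal_basis e S" and S: "closed_subspace S" and f: "orthonormal f" and v: "v \<in> S"
  shows "basis_map f e (basis_map e f v) = v"
  using basis_map_self[OF e S v] cinner_basis_map[OF orthonormal_basisD(1)[OF e] f]
  unfolding basis_map_def[of f e] basis_map_def[of e e] by simp

lemma parseval_tendsto:
  assumes e: "orthonormal_basis e S" and S: "closed_subspace S" and v: "v \<in> S"
  shows "(\<lambda>n. \<Sum>i<n. cinner v (e i) *\<^sub>C e i) \<longlonglongrightarrow> (v::'a::chilbert_space)"
  using summable_LIMSEQ[OF basis_map_summable[of e e v]] orthonormal_basisD(1)[OF e] basis_map_self[OF assms]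
  by (simp add: basis_map_def)

text \<open>The vector v is expanded in \<open>e\<close> and so must lie in S; w enters only through
  its coefficients and is arbitrary.\<close>

lemma cinner_basis_map_basis_map:
  assumes e: "orthonormal_basis e S" and S: "closed_subspace S" and f: "orthonormal f" and v: "v \<in> S"
  shows "cinner (basis_map e f v) (basis_map e f w) = cinner v w"
proof -
  note o = orthonormal_basisD(1)[OF e]
  have "(\<lambda>n. \<Sum>i<n. cinner v (e i) *\<^sub>C f i) \<longlonglongrightarrow> basis_map e f v"
    unfolding basis_map_def by (intro summable_LIMSEQ basis_map_summable o f)
  then have 1: "(\<lambda>n. cinner (\<Sum>i<n. cinner v (e i) *\<^sub>C f i) (basis_map e f w)) \<longlonglongrightarrow> cinner (basis_map e f v) (basis_map e f w)"
    by (intro tendsto_cinner tendsto_const)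
  have "cinner (f i) (basis_map e f w) = cinner (e i) w" for i
    using cinner_basis_map[OF o f, of w i] by (metis cinner_commute)
  then have "cinner (\<Sum>i<n. cinner v (e i) *\<^sub>C f i) (basis_map e f w) = cinner (\<Sum>i<n. cinner v (e i) *\<^sub>C e i) w" for n
    by (simp add: cinner_sum_left cinner_simps)
  moreover have "(\<lambda>n. cinner (\<Sum>i<n. cinner v (e i) *\<^sub>C e i) w) \<longlonglongrightarrow> cinner v w"
    by (intro tendsto_cinner tendsto_const parseval_tendsto[OF e S v])
  ultimately show ?thesis using LIMSEQ_unique[OF 1, of "cinner v w"] by simp
qed

text \<open>Distinct members are at distance sqrt 2, so a point of a countable dense set within 1/2
  of a member determines that member.\<close>

lemma countable_orthonormal_set:
  fixes B :: "'a::complex_inner set"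
  assumes sep: "separable_space (euclidean :: 'a topology)"
    and B: "\<And>a b. a \<in> B \<Longrightarrow> b \<in> B \<Longrightarrow> cinner a b = (if a = b then 1 else 0)"
  shows "countable B"
proof -
  obtain D :: "'a set" where D: "countable D" "closure D = UNIV"
    using sep by (auto simp: separable_space_def)
  have "\<exists>d\<in>D. dist d b < 1/2" for b
    using D(2) closure_approachable[of b D, THEN iffD1, rule_format, of "1/2"] by simp
  then obtain f where f: "\<And>b. f b \<in> D" "\<And>b. dist (f b) b < 1/2" by metis
  have "inj_on f B"
  proof (rule inj_onI, rule ccontr)
    fix a b assume ab: "a \<in> B" "b \<in> B" "f a = f b" "a \<noteq> b"
    have "(norm (a - b))\<^sup>2 = 2"
    proof -
      have "norm a = 1" "norm b = 1"
        using B[OF ab(1,1)] B[OF ab(2,2)] by (simp_all add: norm_eq_sqrt_cinner)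
      then show ?thesis unfolding norm_diff_square B[OF ab(1,2)] using ab(4) by simp
    qed
    moreover have "norm (a - b) < 1"
      using dist_triangle2[of a b "f a"] f(2)[of a] f(2)[of b] ab(3) by (simp add: dist_commute flip: dist_norm)
    then have "(norm (a - b))\<^sup>2 < 1" by (simp add: abs_square_less_1)
    ultimately show False by simp
  qed
  moreover have "countable (f ` B)" 
    by (rule countable_subset[OF _ D(1)]) (use f(1) in blast)
  ultimately show ?thesis by (metis countable_image_inj_on)
qed

text \<open>Zorn's lemma gives a maximal orthonormal subset B of S. It is total, since a nonzero
  vector orthogonal to it could be normalised and added; infinite, since a finite total set would
  span S; and countable by separability, so it can be enumerated.\<close>

lemma exists_orthonormal_basis:
  fixes S :: "'a::complex_inner set"
  assumes sep: "separable_space (euclidean :: 'a topology)"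
    and S: "closed_subspace S" and inf: "infinite_dimensional S"
  shows "\<exists>e. orthonormal_basis e S"
proof -
  define A where "A = {B. B \<subseteq> S \<and> (\<forall>a\<in>B. \<forall>b\<in>B. cinner a b = (if a = b then 1 else 0))}"
  have "\<exists>M\<in>A. \<forall>X\<in>A. M \<subseteq> X \<longrightarrow> X = M"
  proof (rule subset_Zorn')
    fix C assume C: "subset.chain A C"
    then have CA: "C \<subseteq> A" by (simp add: subset.chain_def)
    show "\<Union>C \<in> A"
      unfolding A_def
    proof (intro CollectI conjI ballI)
      show "\<Union>C \<subseteq> S" using CA by (auto simp: A_def)
      fix a b assume "a \<in> \<Union>C" "b \<in> \<Union>C"
      then obtain Y Z where YZ: "a \<in> Y" "Y \<in> C" "b \<in> Z" "Z \<in> C" by blast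
      then have "Y \<subseteq> Z \<or> Z \<subseteq> Y" using C by (auto simp: subset.chain_def)
      then obtain W where "W \<in> C" "a \<in> W" "b \<in> W" using YZ by blast
      then show "cinner a b = (if a = b then 1 else 0)" using CA by (auto simp: A_def)
    qed
  qed
  then obtain B where BA: "B \<in> A" and max: "\<And>X. X \<in> A \<Longrightarrow> B \<subseteq> X \<Longrightarrow> X = B" by blast
  then have B: "\<And>a b. a \<in> B \<Longrightarrow> b \<in> B \<Longrightarrow> cinner a b = (if a = b then 1 else 0)" and BS: "B \<subseteq> S"
    by (auto simp: A_def)
  have total: "v = 0" if v: "v \<in> S" "\<And>b. b \<in> B \<Longrightarrow> cinner v b = 0" for v
  proof (rule ccontr)
    assume nz: "v \<noteq> 0"
    define u where "u = complex_of_real (1 / norm v) *\<^sub>C v"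
    have 1: "cinner u u = 1" using nz by (simp add: u_def cinner_simps cinner_self power2_eq_square norm_divide)
    have ub: "cinner u b = 0" "cinner b u = 0" if "b \<in> B" for b
      using v(2)[OF that] cinner_commute[of b u] by (simp_all add: u_def cinner_simps)
    have 2: "u \<in> S"
      using S v(1) by (simp add: u_def closed_subspace_def complex_vector.subspace_scale)
    have "u \<notin> B" using ub[of u] 1 by auto
    then have "insert u B \<in> A" using BS 1 2 ub B unfolding A_def by (auto simp del: B)
    then show False using max[of "insert u B"] \<open>u \<notin> B\<close> by blast
  qed
  have "infinite B"
  proof
    assume fin: "finite B"
    have "S \<subseteq> complex_vector.span B"
    proof
      fix v assume v: "v \<in> S"
      let ?p = "\<Sum>b\<in>B. cinner v b *\<^sub>C b"
      have "v - ?p = 0"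
      proof (rule total)
        show "v - ?p \<in> S"
          using S v BS unfolding closed_subspace_def
          by (intro complex_vector.subspace_diff complex_vector.subspace_sum complex_vector.subspace_scale) auto
        fix b assume b: "b \<in> B"
        have "cinner ?p b = (\<Sum>a\<in>B. if a = b then cinner v a else 0)"
          unfolding cinner_sum_left using b by (intro sum.cong) (auto simp: cinner_simps B)
        then show "cinner (v - ?p) b = 0" using fin b by (simp add: cinner_simps)
      qed
      moreover have "?p \<in> complex_vector.span B"
        by (intro complex_vector.span_sum complex_vector.span_scale complex_vector.span_base)
      ultimately show "v \<in> complex_vector.span B" by simp
    qed
    then show False using inf fin by (auto simp: infinite_dimensional_def)
  qed
  moreover have "countable B" using countable_orthonormal_set[OF sep] B by blast
  ultimately have bij: "bij_betw (from_nat_into B) UNIV B" by (intro bij_betw_from_nat_into)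
  have "orthonormal_basis (from_nat_into B) S"
    unfolding orthonormal_basis_def orthonormal_def
  proof (intro conjI allI ballI impI)
    show "cinner (from_nat_into B i) (from_nat_into B j) = (if i = j then 1 else 0)" for i j
    proof -
      have "from_nat_into B i \<in> B" for i using bij unfolding bij_betw_def by auto
      moreover have "from_nat_into B i = from_nat_into B j \<longleftrightarrow> i = j"
        using bij unfolding bij_betw_def by (simp add: inj_eq)
      ultimately show ?thesis by (simp add: B)
    qed
    show "range (from_nat_into B) \<subseteq> S" using bij BS unfolding bij_betw_def by auto
    fix v assume "v \<in> S" "\<forall>i. cinner v (from_nat_into B i) = 0"
    then show "v = 0" using total bij unfolding bij_betw_def by (metis rangeE)
  qed
  then show ?thesis by blast
qed

section \<open>Orthogonal complements and vectors with a prescribed Gram matrix\<close>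

definition orthogonal_complement :: "'a::complex_inner set \<Rightarrow> 'a set" where
  "orthogonal_complement S = {v. \<forall>u\<in>S. cinner v u = 0}"

lemma closed_subspace_orthogonal_complement: "closed_subspace (orthogonal_complement S)"
proof -
  have "closed (orthogonal_complement S)"
  proof -
    have "orthogonal_complement S = (\<Inter>u\<in>S. {v. cinner v u = 0})"
      by (auto simp: orthogonal_complement_def)
    moreover have "closed {v. cinner v u = 0}" for u :: 'a
      by (intro closed_Collect_eq continuous_on_cinner_left continuous_on_const)
    ultimately show ?thesis by auto
  qed
  then show ?thesis
    by (auto simp: closed_subspace_def complex_vector.subspace_def orthogonal_complement_def cinner_simps)
qed

lemma orthonormal_not_in_finite_span:
  assumes k: "orthonormal (k :: nat \<Rightarrow> 'a::complex_inner)" and B: "finite B"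
  shows "\<not> range k \<subseteq> complex_vector.span B"
proof
  assume sub: "range k \<subseteq> complex_vector.span B"
  have inj: "inj k"
  proof (rule injI)
    fix i j assume "k i = k j"
    then show "i = j" using orthonormalD[OF k, of i j] orthonormalD[OF k, of i i] by (auto split: if_splits)
  qed
  have "complex_vector.independent (range k)"
    unfolding complex_vector.dependent_explicit
  proof clarify
    fix t u v assume t: "finite t" "t \<subseteq> range k" and s: "(\<Sum>v\<in>t. u v *\<^sub>C v) = 0" and v: "v \<in> t" "u v \<noteq> 0"
    have "cinner (\<Sum>w\<in>t. u w *\<^sub>C w) v = (\<Sum>w\<in>t. if w = v then u w else 0)"
      unfolding cinner_sum_left
    proof (rule sum.cong)
      fix w assume "w \<in> t"
      then obtain i j where "w = k i" "v = k j" using t v by blast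
      then show "cinner (u w *\<^sub>C w) v = (if w = v then u w else 0)"
        using inj by (auto simp: cinner_simps orthonormalD[OF k] inj_eq)
    qed simp
    then show False using s v t(1) by simp
  qed
  then have "finite (range k)" using complex_vector.independent_span_bound[OF B _ sub] by blast
  then show False using inj by (simp add: finite_image_iff)
qed


lemma basis_map_span:
  assumes o: "orthonormal e" "orthonormal f" and v: "v \<in> complex_vector.span B"
  shows "basis_map e f v \<in> complex_vector.span (basis_map e f ` B)"
  using v
proof (induction rule: complex_vector.span_induct_alt)
  case base
  show ?case using basis_map_scaleC[OF o, of 0 0] by (simp add: complex_vector.span_zero)
next
  case (step c x y)
  then show ?case
    unfolding basis_map_add[OF o] basis_map_scaleC[OF o]
    by (intro complex_vector.span_add complex_vector.span_scale) (auto intro: complex_vector.span_base)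
qed

text \<open>The vectors k i - c (cnj (x i)) X, where X is the sum of the x i k i, have the required inner
  products, but for X of norm 1 they span only the complement of X. An isometry from the closure
  of their span onto S makes them total.\<close>

lemma exists_family_with_gram_matrix:
  fixes k :: "nat \<Rightarrow> 'a::chilbert_space" and x :: "nat \<Rightarrow> complex"
  assumes sep: "separable_space (euclidean :: 'a topology)"
    and S: "closed_subspace S" and k: "orthonormal_basis k S"
    and x: "\<And>n. (\<Sum>i<n. (cmod (x i))\<^sup>2) \<le> 1"
  shows "\<exists>y. range y \<subseteq> S \<and>
    (\<forall>i j. cinner (y i) (y j) = (if i = j then 1 else 0) - cnj (x i) * x j) \<and>
    S \<subseteq> closure (complex_vector.span (range y))"
proof -
  note ko = orthonormal_basisD(1)[OF k]
  define X where "X = suminf (\<lambda>i. x i *\<^sub>C k i)"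
  define r where "r = norm X"
  define q where "q = sqrt (1 - r\<^sup>2)"
  \<comment> \<open>The root of 2 c - c^2 r^2 = 1 that stays finite at r = 0. With it,
    \<open>z i\<close> is the image of \<open>k i\<close> under the positive square root of the
    operator v - <v, X> X, and this operator has the required matrix in the basis
    \<open>k\<close>.\<close>
  define c where "c = 1 / (1 + q)"
  have Xk: "cinner X (k j) = x j" "cinner (k j) X = cnj (x j)" for j
    using orthonormal_coeff_suminf[OF ko x, of j] cinner_commute[of "k j" X] by (simp_all add: X_def)
  have "r \<le> 1" unfolding r_def X_def by (rule norm_suminf_orthonormal_le[OF ko]) (use x in auto)
  then have q: "q \<ge> 0" "q\<^sup>2 = 1 - r\<^sup>2"
    by (simp_all add: q_def r_def power_le_one abs_square_le_1)
  have "2 * c - c\<^sup>2 * r\<^sup>2 = 2 * c - c\<^sup>2 * (1 - q\<^sup>2)" using q(2) by simp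
  also have "\<dots> = 2 * c - c * (1 - q) * (c * (1 + q))" by (simp add: algebra_simps power2_eq_square)
  also have "c * (1 + q) = 1" using q(1) by (simp add: c_def)
  also have "2 * c - c * (1 - q) * 1 = c * (1 + q)" by (simp add: algebra_simps)
  also have "c * (1 + q) = 1" using q(1) by (simp add: c_def)
  finally have "complex_of_real (2 * c - c\<^sup>2 * r\<^sup>2) = 1" by simp
  then have c: "2 * complex_of_real c - (complex_of_real c)\<^sup>2 * (complex_of_real r)\<^sup>2 = 1"
    by simp
  define z where "z i = k i - (complex_of_real c * cnj (x i)) *\<^sub>C X" for i
  have zz: "cinner (z i) (z j) = (if i = j then 1 else 0) - cnj (x i) * x j" for i j
  proof -
    have "cinner (z i) (z j) = (if i = j then 1 else 0)
      - cnj (x i) * x j * (2 * complex_of_real c - (complex_of_real c)\<^sup>2 * (complex_of_real r)\<^sup>2)"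
      unfolding z_def by (simp add: cinner_simps Xk orthonormalD[OF ko] cinner_self r_def algebra_simps power2_eq_square)
    then show ?thesis by (simp add: c)
  qed
  define S' where "S' = closure (complex_vector.span (range z))"
  have S': "closed_subspace S'" unfolding S'_def by (rule closed_subspace_closure_span)
  have zS': "z i \<in> S'" for i
    unfolding S'_def by (meson closure_subset complex_vector.span_base rangeI subsetD)
  \<comment> \<open>Each \<open>k i\<close> differs from \<open>z i\<close> by a multiple of X, so
    one more vector in a finite spanning set of S' would span all of \<open>k\<close>.\<close>
  have "infinite_dimensional S'"
    unfolding infinite_dimensional_def
  proof
    assume "\<exists>B. finite B \<and> S' \<subseteq> complex_vector.span B"
    then obtain B where B: "finite B" "S' \<subseteq> complex_vector.span B" by blast
    have "k i \<in> complex_vector.span (insert X B)" for i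
    proof -
      have "z i \<in> complex_vector.span (insert X B)"
        using B(2) zS' complex_vector.span_mono[of B "insert X B"] by blast
      moreover have "k i = z i + (complex_of_real c * cnj (x i)) *\<^sub>C X" by (simp add: z_def)
      ultimately show ?thesis
        using complex_vector.span_add complex_vector.span_scale complex_vector.span_base by (metis insertI1)
    qed
    then have "range k \<subseteq> complex_vector.span (insert X B)" by blast
    then show False using orthonormal_not_in_finite_span[OF ko, of "insert X B"] B(1) by simp
  qed
  then obtain e where e: "orthonormal_basis e S'" using exists_orthonormal_basis[OF sep S'] by blast
  note eo = orthonormal_basisD(1)[OF e]
  define y where "y i = basis_map e k (z i)" for i
  show ?thesis
  proof (intro exI[of _ y] conjI allI)
    show "range y \<subseteq> S"
      using basis_map_in[OF eo ko S] k by (auto simp: y_def orthonormal_basis_def)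
    show "cinner (y i) (y j) = (if i = j then 1 else 0) - cnj (x i) * x j" for i j
      unfolding y_def cinner_basis_map_basis_map[OF e S' ko zS'] by (rule zz)
    show "S \<subseteq> closure (complex_vector.span (range y))"
    proof
      fix w assume w: "w \<in> S"
      have "basis_map k e w \<in> S'"
        using basis_map_in[OF ko eo S'] e by (auto simp: orthonormal_basis_def)
      then obtain f where f: "\<And>n. f n \<in> complex_vector.span (range z)" "f \<longlonglongrightarrow> basis_map k e w"
        unfolding S'_def closure_sequential by blast
      have "(\<lambda>n. basis_map e k (f n)) \<longlonglongrightarrow> basis_map e k (basis_map k e w)"
      proof (rule LIM_zero_cancel, rule Lim_null_comparison)
        have "basis_map e k (f n) - basis_map e k (basis_map k e w) = basis_map e k (f n - basis_map k e w)" for n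
          using basis_map_add[OF eo ko, of "f n - basis_map k e w" "basis_map k e w"] by (simp add: algebra_simps)
        then show "\<forall>\<^sub>F n in sequentially. norm (basis_map e k (f n) - basis_map e k (basis_map k e w))
            \<le> norm (f n - basis_map k e w)"
          using norm_basis_map_le[OF eo ko] by simp
        show "(\<lambda>n. norm (f n - basis_map k e w)) \<longlonglongrightarrow> 0"
          using f(2) by (simp add: LIM_zero tendsto_norm_zero)
      qed
      moreover have "basis_map e k (basis_map k e w) = w"
        by (rule basis_map_inverse[OF k S eo w])
      moreover have "basis_map e k (f n) \<in> complex_vector.span (range y)" for n
      proof -
        have "basis_map e k ` range z = range y" by (auto simp: y_def)
        then show ?thesis using basis_map_span[OF eo ko f(1)] by metis
      qed
      ultimately show "w \<in> closure (complex_vector.span (range y))"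
        unfolding closure_sequential by (intro exI[of _ "\<lambda>n. basis_map e k (f n)"]) simp
    qed
  qed
qed

section \<open>Vector fields on finite-dimensional balls\<close>

text \<open>Otherwise the identity of the sphere is homotopic in the complement of the origin
  first to the restriction of a, along straight lines, and then to the constant a 0.\<close>

lemma vector_field_zero_or_radial:
  fixes a :: "nat \<Rightarrow> (nat \<Rightarrow> real) \<Rightarrow> real" and n :: nat
  defines "D \<equiv> {x. (\<Sum>i\<le>n. (x i)\<^sup>2) \<le> 1 \<and> (\<forall>i>n. x i = 0)}"
  assumes cont: "\<And>i. i \<le> n \<Longrightarrow> continuous_on D (a i)"
  shows "\<exists>x\<in>D. (\<forall>i\<le>n. a i x = 0) \<or>
    ((\<Sum>i\<le>n. (x i)\<^sup>2) = 1 \<and> (\<exists>r. \<forall>i\<le>n. a i x = r * x i))"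
proof (rule ccontr)
  assume "\<not> ?thesis"
  then have nz: "x \<in> D \<Longrightarrow> (\<And>i. i \<le> n \<Longrightarrow> a i x = 0) \<Longrightarrow> False"
    and nr: "x \<in> D \<Longrightarrow> (\<Sum>i\<le>n. (x i)\<^sup>2) = 1 \<Longrightarrow> (\<And>i. i \<le> n \<Longrightarrow> a i x = r * x i) \<Longrightarrow> False" for x r
    by blast+
  define S where "S = {x. (\<Sum>i\<le>n. (x i)\<^sup>2) = 1 \<and> (\<forall>i>n. x i = (0::real))}"
  have SD: "S \<subseteq> D" by (auto simp: S_def D_def)
  \<comment> \<open>The two homotopies run one after the other. For t up to 1/2, \<open>sc\<close>
    is x and \<open>v\<close> moves from x to a x along a segment; afterwards \<open>v\<close> is a
    at a point whose radius shrinks as 2 - 2 t. The minima and maxima write both halves as one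
    continuous formula.\<close>
  define sc :: "real \<times> (nat \<Rightarrow> real) \<Rightarrow> nat \<Rightarrow> real" where "sc = (\<lambda>(t, x) i. min 1 (2 - 2 * t) * x i)"
  define v where "v p i = max 0 (1 - 2 * fst p) * snd p i + min 1 (2 * fst p) * a i (sc p)" for p i
  define N where "N p = sqrt (\<Sum>i\<le>n. (v p i)\<^sup>2)" for p
  define h where "h p = (\<lambda>i. if i \<le> n then v p i / N p else 0)" for p
  have scD: "sc p \<in> D" if "p \<in> {0..1} \<times> S" for p
  proof -
    obtain t x where p: "p = (t, x)" by (cases p)
    have "(min 1 (2 - 2 * t))\<^sup>2 * (\<Sum>i\<le>n. (x i)\<^sup>2) \<le> 1"
      using that by (simp add: p S_def power_le_one)
    then show ?thesis using that by (simp add: p sc_def D_def S_def power_mult_distrib sum_distrib_left)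
  qed
  have csnd: "continuous_on ({0..1} \<times> S) (\<lambda>p. snd p i)" for i
    by (rule continuous_on_compose2[OF continuous_on_product_coordinates continuous_on_snd[OF continuous_on_id]]) auto
  have "continuous_on ({0..1} \<times> S) sc"
    unfolding sc_def case_prod_beta
    by (rule continuous_on_coordinatewise_then_product) (intro continuous_intros csnd)
  then have ca: "continuous_on ({0..1} \<times> S) (\<lambda>p. a i (sc p))" if "i \<le> n" for i
    by (rule continuous_on_compose2[OF cont[OF that]]) (use scD in auto)
  have cv: "continuous_on ({0..1} \<times> S) (\<lambda>p. v p i)" if "i \<le> n" for i
    unfolding v_def by (intro continuous_intros csnd ca that)
  have Nnz: "N p \<noteq> 0" if pS: "p \<in> {0..1} \<times> S" for p
  proof
    assume "N p = 0"
    then have "(\<Sum>i\<le>n. (v p i)\<^sup>2) = 0" by (simp add: N_def)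
    then have v0: "v p i = 0" if "i \<le> n" for i using that by (subst (asm) sum_nonneg_eq_0_iff) auto
    obtain t x where p: "p = (t, x)" by (cases p)
    have x: "x \<in> S" "0 \<le> t" "t \<le> 1" using pS by (auto simp: p)
    then have x1: "(\<Sum>i\<le>n. (x i)\<^sup>2) = 1" by (simp add: S_def)
    consider "t = 0" | "0 < t" "t \<le> 1/2" | "1/2 < t" using x by linarith
    then show False
    proof cases
      case 1
      then have "x i = 0" if "i \<le> n" for i using v0[OF that] by (simp add: v_def p)
      then show False using x1 by simp
    next
      case 2
      have "sc p = x" using 2 by (simp add: sc_def p fun_eq_iff)
      then have "a i x = - (1 - 2 * t) / (2 * t) * x i" if "i \<le> n" for i
        using v0[OF that] 2 by (simp add: v_def p field_simps)
      then show False using nr[of x] x x1 SD by blast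
    next
      case 3
      then have "a i (sc p) = 0" if "i \<le> n" for i
        using v0[OF that] by (simp add: v_def p)
      then show False using nz[OF scD[OF pS]] by blast
    qed
  qed
  have hS: "h p \<in> S" if "p \<in> {0..1} \<times> S" for p
  proof -
    have "(N p)\<^sup>2 = (\<Sum>i\<le>n. (v p i)\<^sup>2)" by (simp add: N_def sum_nonneg)
    then have "(\<Sum>i\<le>n. (v p i / N p)\<^sup>2) = (N p)\<^sup>2 / (N p)\<^sup>2"
      by (simp add: power_divide flip: sum_divide_distrib)
    then show ?thesis using Nnz[OF that] by (simp add: S_def h_def)
  qed
  have "continuous_on ({0..1} \<times> S) h"
  proof (rule continuous_on_coordinatewise_then_product)
    fix i
    have "continuous_on ({0..1} \<times> S) N"
      unfolding N_def by (intro continuous_intros cv) auto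
    then show "continuous_on ({0..1} \<times> S) (\<lambda>p. h p i)"
      unfolding h_def using cv[of i] Nnz by (cases "i \<le> n") (auto intro!: continuous_intros)
  qed
  moreover have "h (0, x) = x" if "x \<in> S" for x
  proof -
    have "v (0, x) i = x i" for i by (simp add: v_def)
    moreover from this have "N (0, x) = 1" using that by (simp add: N_def S_def)
    ultimately show ?thesis using that by (auto simp: h_def S_def fun_eq_iff)
  qed
  moreover have "h (1, x) = h (1, y)" for x y
  proof -
    have "v (1, x) i = v (1, y) i" for i by (simp add: v_def sc_def)
    then show ?thesis unfolding h_def N_def by presburger
  qed
  ultimately have "homotopic_with_canon (\<lambda>_. True) S S id (\<lambda>x. h (1, undefined))"
    using hS by (subst homotopic_with) (auto intro!: exI[of _ h] simp: prod_topology_subtopology_eu)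
  then have "contractible S" unfolding contractible_def by blast
  moreover have "nsphere n = top_of_set S" by (simp add: nsphere S_def euclidean_product_topology)
  ultimately show False using non_contractible_space_nsphere[of n] by simp
qed

section \<open>Complex coordinates and the unit ball of l2\<close>

lemma sum_even_odd_pairs: "(\<Sum>j<2 * N. f j) = (\<Sum>i<N. f (2 * i) + (f (Suc (2 * i)) :: real))"
  by (induction N) auto

text \<open>As a subset of a function type it carries the product topology, which on the unit ball
  of l2 is the weak topology.\<close>

definition l2_ball :: "(nat \<Rightarrow> complex) set" where
  "l2_ball = {x. \<forall>n. (\<Sum>i<n. (cmod (x i))\<^sup>2) \<le> 1}"

text \<open>Real coordinates 2 i and 2 i + 1 are the real and imaginary parts of the complex
  coordinate i, and the remaining complex coordinates are padded with zeros. The case r = 0 encodes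
  a zero of the field.\<close>

lemma complex_vector_field_zero_or_radial:
  fixes b :: "nat \<Rightarrow> (nat \<Rightarrow> complex) \<Rightarrow> complex"
  assumes cont: "\<And>i. i < N \<Longrightarrow> continuous_on l2_ball (b i)"
  shows "\<exists>x\<in>l2_ball. \<exists>r. (\<forall>i<N. b i x = r * x i) \<and> (r = 0 \<or> (\<Sum>i<N. (cmod (x i))\<^sup>2) = 1)"
proof (cases "N = 0")
  case True
  then show ?thesis by (intro bexI[of _ "\<lambda>_. 0"]) (auto simp: l2_ball_def)
next
  case False
  \<comment> \<open>The real lemma uses the coordinates 0 to n, that is n + 1 of them, which is 2 N
    here. There is always at least one, so N = 0 was treated apart.\<close>
  define n where "n = 2 * N - 1"
  have le_n: "{..n} = {..<2 * N}" using False by (auto simp: n_def)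
  define d :: "(nat \<Rightarrow> real) \<Rightarrow> nat \<Rightarrow> complex"
    where "d x i = (if i < N then Complex (x (2 * i)) (x (Suc (2 * i))) else 0)" for x i
  define a where "a j x = (if even j then Re (b (j div 2) (d x)) else Im (b (j div 2) (d x)))" for j x
  let ?D = "{x. (\<Sum>i\<le>n. (x i)\<^sup>2) \<le> 1 \<and> (\<forall>i>n. x i = 0)}"
  have sum_d: "(\<Sum>i<N. (cmod (d x i))\<^sup>2) = (\<Sum>j\<le>n. (x j)\<^sup>2)" for x
    unfolding le_n sum_even_odd_pairs by (simp add: d_def cmod_power2)
  have d_ball: "d x \<in> l2_ball" if "(\<Sum>j\<le>n. (x j)\<^sup>2) \<le> 1" for x
    unfolding l2_ball_def
  proof (intro CollectI allI)
    fix m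
    have "(\<Sum>i<m. (cmod (d x i))\<^sup>2) = (\<Sum>i\<in>{..<m} \<inter> {..<N}. (cmod (d x i))\<^sup>2)"
      by (rule sum.mono_neutral_right) (auto simp: d_def)
    also have "\<dots> \<le> (\<Sum>i<N. (cmod (d x i))\<^sup>2)" by (rule sum_mono2) auto
    finally show "(\<Sum>i<m. (cmod (d x i))\<^sup>2) \<le> 1" using that sum_d by simp
  qed
  have "continuous_on ?D d"
  proof (rule continuous_on_coordinatewise_then_product)
    fix i
    have "continuous_on ?D (\<lambda>x. x j :: real)" for j :: nat
      by (rule continuous_on_subset[OF continuous_on_product_coordinates]) simp
    then show "continuous_on ?D (\<lambda>x. d x i)"
      unfolding d_def Complex_eq by (cases "i < N") (auto intro!: continuous_intros)
  qed
  then have "continuous_on ?D (\<lambda>x. b i (d x))" if "i < N" for i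
    by (rule continuous_on_compose2[OF cont[OF that]]) (use d_ball in auto)
  then have "continuous_on ?D (a j)" if "j \<le> n" for j
    unfolding a_def using that False by (cases "even j") (auto intro!: continuous_intros simp: n_def)
  from vector_field_zero_or_radial[of n a, OF this] obtain x where x: "(\<Sum>i\<le>n. (x i)\<^sup>2) \<le> 1"
    and ax: "(\<forall>i\<le>n. a i x = 0) \<or> ((\<Sum>i\<le>n. (x i)\<^sup>2) = 1 \<and> (\<exists>r. \<forall>i\<le>n. a i x = r * x i))"
    by auto
  have b: "b i (d x) = Complex (a (2 * i) x) (a (Suc (2 * i)) x)" for i
    by (simp add: a_def complex_eq_iff)
  have le: "2 * i \<le> n" "Suc (2 * i) \<le> n" if "i < N" for i using that by (auto simp: n_def)
  from ax show ?thesis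
  proof
    assume "\<forall>i\<le>n. a i x = 0"
    then show ?thesis
      using d_ball[OF x] by (intro bexI[of _ "d x"] exI[of _ 0]) (auto simp: b le complex_eq_iff)
  next
    assume "(\<Sum>i\<le>n. (x i)\<^sup>2) = 1 \<and> (\<exists>r. \<forall>i\<le>n. a i x = r * x i)"
    then obtain r where "(\<Sum>i\<le>n. (x i)\<^sup>2) = 1" "\<forall>i\<le>n. a i x = r * x i" by blast
    then show ?thesis
      using d_ball[OF x]
      by (intro bexI[of _ "d x"] exI[of _ "complex_of_real r"] conjI disjI2)
        (simp_all only: sum_d, auto simp: b le d_def complex_eq_iff)
  qed
qed

text \<open>By Tychonoff: the ball is closed in a product of unit discs, because each of its
  defining inequalities involves finitely many coordinates.\<close>

lemma compact_l2_ball: "compact l2_ball"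
proof -
  have "compact (PiE UNIV (\<lambda>_::nat. cball (0::complex) 1))"
    unfolding compactin_euclidean_iff[symmetric] euclidean_product_topology[symmetric]
    by (simp add: compactin_PiE)
  moreover have "closed l2_ball"
  proof -
    have eq: "l2_ball = (\<Inter>n. {x. (\<Sum>i<n. (cmod (x i))\<^sup>2) \<le> 1})" by (auto simp: l2_ball_def)
    have "closed {x :: nat \<Rightarrow> complex. (\<Sum>i<n. (cmod (x i))\<^sup>2) \<le> 1}" for n
      by (intro closed_Collect_le continuous_intros continuous_on_product_coordinates)
    then show ?thesis unfolding eq by (intro closed_INT ballI)
  qed
  moreover have "l2_ball \<subseteq> PiE UNIV (\<lambda>_. cball 0 1)"
  proof
    fix x assume x: "x \<in> l2_ball"
    have "cmod (x i) \<le> 1" for i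
    proof -
      have "(cmod (x i))\<^sup>2 \<le> (\<Sum>j<Suc i. (cmod (x j))\<^sup>2)" by (simp add: sum_nonneg)
      also have "\<dots> \<le> 1" using x by (simp add: l2_ball_def del: sum.lessThan_Suc)
      finally show ?thesis by (simp add: abs_square_le_1)
    qed
    then show "x \<in> PiE UNIV (\<lambda>_. cball 0 1)" by auto
  qed
  ultimately show ?thesis using compact_Int_closed by (metis inf.absorb_iff2)
qed

section \<open>A field of Hilbert spaces without nonvanishing sections\<close>

text \<open>The coefficients are made to vanish from N on so that combinations of different lengths
  can later be extended to a common length.\<close>

lemma span_range_sum:
  assumes "v \<in> complex_vector.span (range (f :: nat \<Rightarrow> 'a::complex_inner))"
  shows "\<exists>a N. (\<forall>i\<ge>N. a i = 0) \<and> v = (\<Sum>i<N. a i *\<^sub>C f i)"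
  using assms
proof (induction rule: complex_vector.span_induct_alt)
  case base
  show ?case by (intro exI[of _ "\<lambda>_. 0"] exI[of _ 0]) simp
next
  case (step c x y)
  then obtain a N j where a: "\<forall>i\<ge>N. a i = 0" "y = (\<Sum>i<N. a i *\<^sub>C f i)" and j: "x = f j" by blast
  define M where "M = max N (Suc j)"
  have "(\<Sum>i<M. (a i + (if i = j then c else 0)) *\<^sub>C f i) = (\<Sum>i<M. a i *\<^sub>C f i) + (\<Sum>i<M. if i = j then c *\<^sub>C f i else 0)"
    by (simp add: scaleC_add_left sum.distrib if_distrib[of "\<lambda>c. c *\<^sub>C _"] cong: if_cong)
  also have "(\<Sum>i<M. a i *\<^sub>C f i) = y"
    unfolding a(2) by (rule sum.mono_neutral_right) (use a(1) in \<open>auto simp: M_def\<close>)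
  also have "(\<Sum>i<M. if i = j then c *\<^sub>C f i else 0) = c *\<^sub>C x"
    by (simp add: M_def j less_max_iff_disj)
  finally show ?case
    using a(1) by (intro exI[of _ "\<lambda>i. a i + (if i = j then c else 0)"] exI[of _ M]) (auto simp: M_def)
qed

lemma continuous_on_scaleC:
  fixes f :: "'b::topological_space \<Rightarrow> 'a::complex_inner"
  shows "continuous_on S c \<Longrightarrow> continuous_on S f \<Longrightarrow> continuous_on S (\<lambda>x. c x *\<^sub>C f x)"
  unfolding continuous_on_def by (intro ballI tendsto_scaleC) auto

text \<open>If s vanishes nowhere, a partition of unity glues approximations of s into a nowhere
  vanishing combination of z 0, ..., z (M - 1) with continuous coefficients b. But b has a zero
  or is radial somewhere on the unit sphere, where the combination of the z i with coefficients
  x i vanishes.\<close>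

lemma section_vanishes:
  fixes z :: "nat \<Rightarrow> (nat \<Rightarrow> complex) \<Rightarrow> 'a::complex_inner"
  assumes z: "\<And>i. continuous_on l2_ball (z i)"
    and gram: "\<And>x i j. x \<in> l2_ball \<Longrightarrow> cinner (z i x) (z j x) = (if i = j then 1 else 0) - cnj (x i) * x j"
    and s: "continuous_on l2_ball s"
    and s_in: "\<And>x. x \<in> l2_ball \<Longrightarrow> s x \<in> closure (complex_vector.span (range (\<lambda>i. z i x)))"
  shows "\<exists>x\<in>l2_ball. s x = 0"
proof (rule ccontr)
  assume "\<not> ?thesis"
  then have nz: "s x \<noteq> 0" if "x \<in> l2_ball" for x using that by blast
  have "\<exists>a N. (\<forall>i\<ge>N. a i = 0) \<and> norm (s x - (\<Sum>i<N. a i *\<^sub>C z i x)) < norm (s x)" if x: "x \<in> l2_ball" for x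
  proof -
    obtain v where v: "v \<in> complex_vector.span (range (\<lambda>i. z i x))" "dist v (s x) < norm (s x)"
      using s_in[OF x] nz[OF x] unfolding closure_approachable by (meson zero_less_norm_iff)
    obtain a N where "\<forall>i\<ge>N. a i = 0" "v = (\<Sum>i<N. a i *\<^sub>C z i x)"
      using span_range_sum[OF v(1)] by blast
    then show ?thesis
      using v(2) by (intro exI[of _ a] exI[of _ N]) (simp add: dist_norm norm_minus_commute)
  qed
  then obtain A N where A0: "\<And>x i. x \<in> l2_ball \<Longrightarrow> i \<ge> N x \<Longrightarrow> A x i = 0"
    and A: "\<And>x. x \<in> l2_ball \<Longrightarrow> norm (s x - (\<Sum>i<N x. A x i *\<^sub>C z i x)) < norm (s x)" by metis
  define u where "u p x = (\<Sum>i<N p. A p i *\<^sub>C z i x)" for p x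
  \<comment> \<open>Positive exactly where \<open>u p x\<close> is nearer to \<open>s x\<close> than
    0 is. These weights are left unnormalised.\<close>
  define \<phi> where "\<phi> p x = max 0 (norm (s x) - norm (s x - u p x))" for p x
  have cu: "continuous_on l2_ball (u p)" for p
    unfolding u_def by (intro continuous_intros continuous_on_scaleC z)
  have c\<phi>: "continuous_on l2_ball (\<phi> p)" for p
    unfolding \<phi>_def by (intro continuous_intros cu s)
  define W where "W p = l2_ball \<inter> \<phi> p -` {0<..}" for p
  have "openin (top_of_set l2_ball) (W p)" for p
    unfolding W_def by (rule continuous_openin_preimage_gen[OF c\<phi>]) simp
  moreover have "l2_ball \<subseteq> \<Union>(W ` l2_ball)"
    using A by (auto simp: W_def \<phi>_def u_def)
  ultimately obtain D where D: "D \<subseteq> W ` l2_ball" "finite D" "l2_ball \<subseteq> \<Union>D"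
    using compact_l2_ball[unfolded compact_eq_openin_cover, rule_format, of "W ` l2_ball"] by blast
  obtain J where J: "J \<subseteq> l2_ball" "finite J" "l2_ball \<subseteq> \<Union>(W ` J)"
    using finite_subset_image[OF D(2,1)] D(3) by metis
  define M where "M = (\<Sum>p\<in>J. N p)"
  have NM: "N p \<le> M" if "p \<in> J" for p using that J(2) by (auto simp: M_def intro: member_le_sum)
  \<comment> \<open>Coefficients of the weighted sum of the \<open>u p x\<close> over J. They depend
    on x only through the weights and are therefore continuous.\<close>
  define b where "b i x = (\<Sum>p\<in>J. complex_of_real (\<phi> p x) * A p i)" for i x
  have "continuous_on l2_ball (b i)" for i
    unfolding b_def by (intro continuous_intros c\<phi>)
  from complex_vector_field_zero_or_radial[of M b, OF this]
  obtain x r where x: "x \<in> l2_ball" and bx: "\<And>i. i < M \<Longrightarrow> b i x = r * x i"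
    and r: "r = 0 \<or> (\<Sum>i<M. (cmod (x i))\<^sup>2) = 1" by blast
  define w where "w = (\<Sum>i<M. x i *\<^sub>C z i x)"
  \<comment> \<open>With t the sum of the squared moduli of the \<open>x i\<close> for i < M, the
    Gram matrix gives t - t^2.\<close>
  have "cinner w w = (\<Sum>i<M. \<Sum>j<M. x i * cnj (x j) * ((if i = j then 1 else 0) - cnj (x i) * x j))"
  proof -
    have "cinner (z i x) w = (\<Sum>j<M. cnj (x j) * ((if i = j then 1 else 0) - cnj (x i) * x j))" for i
      unfolding w_def by (simp add: cinner_sum_right cinner_scaleC_right gram[OF x])
    moreover have "cinner w w = (\<Sum>i<M. x i * cinner (z i x) w)"
      by (subst w_def) (simp add: cinner_sum_left cinner_scaleC_left)
    ultimately show ?thesis by (simp add: sum_distrib_left mult.assoc)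
  qed
  also have "\<dots> = (\<Sum>i<M. \<Sum>j<M. (if i = j then x i * cnj (x j) else 0) - (x i * cnj (x i)) * (x j * cnj (x j)))"
    by (intro sum.cong refl) (simp add: algebra_simps)
  also have "\<dots> = (\<Sum>i<M. x i * cnj (x i)) - (\<Sum>i<M. x i * cnj (x i)) * (\<Sum>j<M. x j * cnj (x j))"
    by (simp add: sum_subtractf sum_product)
  also have "(\<Sum>i<M. x i * cnj (x i)) = complex_of_real (\<Sum>i<M. (cmod (x i))\<^sup>2)"
    by (simp add: mult_cnj_cmod)
  finally have ww: "cinner w w = complex_of_real (\<Sum>i<M. (cmod (x i))\<^sup>2)
    - complex_of_real (\<Sum>i<M. (cmod (x i))\<^sup>2) * complex_of_real (\<Sum>i<M. (cmod (x i))\<^sup>2)" .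
  from r have "r *\<^sub>C w = 0"
  proof
    assume "(\<Sum>i<M. (cmod (x i))\<^sup>2) = 1"
    then have "cinner w w = 0" unfolding ww by simp
    then show ?thesis by (simp add: cinner_self)
  qed simp
  moreover have "r *\<^sub>C w = (\<Sum>i<M. b i x *\<^sub>C z i x)"
    unfolding w_def complex_vector.scale_sum_right by (intro sum.cong refl) (simp add: scaleC_scaleC bx)
  moreover have "\<dots> = (\<Sum>i<M. \<Sum>p\<in>J. \<phi> p x *\<^sub>R A p i *\<^sub>C z i x)"
    by (simp add: b_def complex_vector.scale_sum_left scaleR_scaleC scaleC_scaleC)
  moreover have "\<dots> = (\<Sum>p\<in>J. \<phi> p x *\<^sub>R (\<Sum>i<M. A p i *\<^sub>C z i x))"
    by (subst sum.swap) (simp add: scaleR_sum_right)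
  moreover have "(\<Sum>i<M. A p i *\<^sub>C z i x) = u p x" if "p \<in> J" for p
    unfolding u_def by (rule sum.mono_neutral_right) (use A0[of p] J(1) NM that in auto)
  ultimately have 0: "(\<Sum>p\<in>J. \<phi> p x *\<^sub>R u p x) = 0" by simp
  have "(\<Sum>p\<in>J. \<phi> p x) \<ge> 0" by (simp add: \<phi>_def sum_nonneg)
  \<comment> \<open>The weighted sum of the \<open>u p x\<close> vanishes, so subtracting it from
    the weighted sum of \<open>s x\<close> changes nothing. But every positive weight belongs to a
    \<open>u p x\<close> with error smaller than the norm of \<open>s x\<close>, and at least one
    weight is positive.\<close>
  then have "(\<Sum>p\<in>J. \<phi> p x) * norm (s x) = norm (\<Sum>p\<in>J. \<phi> p x *\<^sub>R (s x - u p x))"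
    by (simp add: scaleR_diff_right sum_subtractf 0 flip: scaleR_left.sum)
  also have "\<dots> \<le> (\<Sum>p\<in>J. \<phi> p x * norm (s x - u p x))"
    by (rule order_trans[OF norm_sum]) (simp add: \<phi>_def)
  also have "\<dots> < (\<Sum>p\<in>J. \<phi> p x * norm (s x))"
  proof (rule sum_strict_mono_ex1[OF J(2)])
    show "\<forall>p\<in>J. \<phi> p x * norm (s x - u p x) \<le> \<phi> p x * norm (s x)"
      by (auto simp: \<phi>_def max_def mult_left_mono)
    obtain p where "p \<in> J" "\<phi> p x > 0" using J(3) x by (auto simp: W_def)
    then show "\<exists>p\<in>J. \<phi> p x * norm (s x - u p x) < \<phi> p x * norm (s x)"
      by (intro bexI[of _ p]) (auto simp: \<phi>_def max_def split: if_splits intro!: mult_strict_left_mono)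
  qed
  finally show False by (simp add: sum_distrib_right)
qed

section \<open>Unitary operators\<close>

lemma unitariesD:
  assumes "F \<in> unitaries"
  shows "blinfun_apply F (c *\<^sub>C x) = c *\<^sub>C blinfun_apply F x"
    and "cinner (blinfun_apply F x) (blinfun_apply F y) = cinner x y"
    and "surj (blinfun_apply F)"
  using assms by (auto simp: unitaries_def)

lemma unitary_norm: "F \<in> unitaries \<Longrightarrow> norm (blinfun_apply F x) = norm x"
  by (simp add: norm_eq_sqrt_cinner unitariesD(2))

lemma unitary_inj: "F \<in> unitaries \<Longrightarrow> inj (blinfun_apply F)"
  by (rule injI) (metis blinfun.diff_right eq_iff_diff_eq_0 norm_eq_zero unitary_norm)

lemma unitaries_compose: "E \<in> unitaries \<Longrightarrow> F \<in> unitaries \<Longrightarrow> E o\<^sub>L F \<in> unitaries"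
  unfolding unitaries_def by (auto simp: o_def dest: comp_surj[of "blinfun_apply F" "blinfun_apply E"])

lemma unitary_inverse:
  assumes F: "F \<in> unitaries"
  shows "\<exists>E\<in>unitaries. E o\<^sub>L F = id_blinfun"
proof -
  let ?f = "blinfun_apply F"
  let ?e = "Hilbert_Choice.inv ?f"
  have fe: "?f (?e x) = x" for x by (rule surj_f_inv_f[OF unitariesD(3)[OF F]])
  have ef: "?e (?f x) = x" for x by (rule inv_f_f[OF unitary_inj[OF F]])
  have "bounded_linear ?e"
  proof (rule bounded_linear_intro[where K = 1])
    show "?e (x + y) = ?e x + ?e y" for x y
      using ef[of "?e x + ?e y"] by (simp add: blinfun.add_right fe)
    show "?e (r *\<^sub>R x) = r *\<^sub>R ?e x" for r x
      using ef[of "r *\<^sub>R ?e x"] by (simp add: blinfun.scaleR_right fe)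
    show "norm (?e x) \<le> norm x * 1" for x
      using unitary_norm[OF F, of "?e x"] by (simp add: fe)
  qed
  then have E: "blinfun_apply (Blinfun ?e) = ?e" by (rule bounded_linear_Blinfun_apply)
  have "Blinfun ?e \<in> unitaries"
    unfolding unitaries_def mem_Collect_eq E
  proof (intro conjI allI)
    show "?e (c *\<^sub>C x) = c *\<^sub>C ?e x" for c x
      using ef[of "c *\<^sub>C ?e x"] by (simp add: unitariesD(1)[OF F] fe)
    show "cinner (?e x) (?e y) = cinner x y" for x y
      using unitariesD(2)[OF F, of "?e x" "?e y"] by (simp add: fe)
    show "surj ?e" by (rule surjI[of _ ?f]) (rule ef)
  qed
  moreover have "Blinfun ?e o\<^sub>L F = id_blinfun" by (rule blinfun_eqI) (simp add: E ef)
  ultimately show ?thesis by blast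
qed

lemma unitary_group_group: "Group.group (unitary_group :: ('h::chilbert_space \<Rightarrow>\<^sub>L 'h) monoid)"
proof (rule Group.groupI)
  show "\<one>\<^bsub>unitary_group\<^esub> \<in> carrier (unitary_group :: ('h \<Rightarrow>\<^sub>L 'h) monoid)"
    by (auto simp: unitary_group_def unitaries_def)
qed (auto simp: unitary_group_def unitaries_compose unitary_inverse intro!: blinfun_eqI)

lemma unitary_inv:
  assumes "F \<in> unitaries"
  shows "inv\<^bsub>unitary_group\<^esub> F \<in> unitaries"
    and "blinfun_apply (inv\<^bsub>unitary_group\<^esub> F) (blinfun_apply F x) = x"
    and "blinfun_apply F (blinfun_apply (inv\<^bsub>unitary_group\<^esub> F) x) = x"
proof -
  interpret Group.group "unitary_group :: ('a \<Rightarrow>\<^sub>L 'a) monoid" by (rule unitary_group_group)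
  have F: "F \<in> carrier unitary_group" using assms by (simp add: unitary_group_def)
  show "inv\<^bsub>unitary_group\<^esub> F \<in> unitaries" using inv_closed[OF F] by (simp add: unitary_group_def)
  have "inv\<^bsub>unitary_group\<^esub> F o\<^sub>L F = id_blinfun" "F o\<^sub>L inv\<^bsub>unitary_group\<^esub> F = id_blinfun"
    using l_inv[OF F] r_inv[OF F] by (simp_all add: unitary_group_def)
  then show "blinfun_apply (inv\<^bsub>unitary_group\<^esub> F) (blinfun_apply F x) = x"
    "blinfun_apply F (blinfun_apply (inv\<^bsub>unitary_group\<^esub> F) x) = x"
    by (metis blinfun_apply_blinfun_compose blinfun_apply_id_blinfun id_apply)+
qed

lemma basis_map_unitary:
  assumes c: "orthonormal_basis c UNIV" and h: "orthonormal_basis (h :: nat \<Rightarrow> 'h::chilbert_space) UNIV"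
  shows "\<exists>F\<in>unitaries. blinfun_apply F = basis_map c h"
proof -
  note co = orthonormal_basisD(1)[OF c] and ho = orthonormal_basisD(1)[OF h]
  have "bounded_linear (basis_map c h)"
    by (rule bounded_linear_intro[where K = 1])
      (simp_all add: basis_map_add[OF co ho] scaleR_scaleC basis_map_scaleC[OF co ho] norm_basis_map_le[OF co ho])
  then have F: "blinfun_apply (Blinfun (basis_map c h)) = basis_map c h" by (rule bounded_linear_Blinfun_apply)
  have "Blinfun (basis_map c h) \<in> unitaries"
    unfolding unitaries_def mem_Collect_eq F
  proof (intro conjI allI)
    show "basis_map c h (a *\<^sub>C x) = a *\<^sub>C basis_map c h x" for a x by (rule basis_map_scaleC[OF co ho])
    show "cinner (basis_map c h x) (basis_map c h y) = cinner x y" for x y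
      by (rule cinner_basis_map_basis_map[OF c closed_subspace_UNIV ho]) simp
    show "surj (basis_map c h)"
      by (rule surjI[of _ "basis_map h c"]) (rule basis_map_inverse[OF h closed_subspace_UNIV co], simp)
  qed
  then show ?thesis using F by blast
qed

text \<open>Weak convergence with convergence of norms is norm convergence. If w is a finite
  truncation of l, the squared distance from f to w involves only the norm of f and finitely many
  coordinates. This turns continuity of inner products into continuity of vectors.\<close>

lemma tendsto_of_coordinates:
  fixes f :: "'b \<Rightarrow> 'h::chilbert_space"
  assumes h: "orthonormal_basis h UNIV"
    and coord: "\<And>n. ((\<lambda>x. cinner (f x) (h n)) \<longlongrightarrow> cinner l (h n)) F"
    and nrm: "((\<lambda>x. norm (f x)) \<longlongrightarrow> norm l) F"
  shows "(f \<longlongrightarrow> l) F"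
proof (rule tendstoI)
  fix \<epsilon> :: real assume \<epsilon>: "\<epsilon> > 0"
  obtain N where N: "dist (\<Sum>i<N. cinner l (h i) *\<^sub>C h i) l < \<epsilon> / 2"
    using parseval_tendsto[OF h closed_subspace_UNIV, of l, THEN tendstoD, of "\<epsilon> / 2"] \<epsilon>
    by (auto simp: eventually_sequentially)
  define w where "w = (\<Sum>i<N. cinner l (h i) *\<^sub>C h i)"
  have cw: "cinner v w = (\<Sum>i<N. cnj (cinner l (h i)) * cinner v (h i))" for v
    by (simp add: w_def cinner_sum_right cinner_scaleC_right)
  have "((\<lambda>x. (norm (f x - w))\<^sup>2) \<longlongrightarrow> (norm (l - w))\<^sup>2) F"
    unfolding norm_diff_square cw by (intro tendsto_intros coord nrm)
  moreover have lw: "norm (l - w) < \<epsilon> / 2" using N by (simp add: w_def dist_norm norm_minus_commute)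
  then have "(norm (l - w))\<^sup>2 < (\<epsilon> / 2)\<^sup>2" by (simp add: power_strict_mono)
  ultimately have "\<forall>\<^sub>F x in F. (norm (f x - w))\<^sup>2 < (\<epsilon> / 2)\<^sup>2" by (rule order_tendstoD)
  then show "\<forall>\<^sub>F x in F. dist (f x) l < \<epsilon>"
  proof eventually_elim
    case (elim x)
    then have "norm (f x - w) < \<epsilon> / 2" using \<epsilon> power_less_imp_less_base[OF elim] by simp
    then show ?case using lw norm_triangle_ineq4[of "f x - w" "l - w"] by (simp add: dist_norm)
  qed
qed

text \<open>Linearity gives convergence on finite combinations of the basis; unitaries preserve
  norms, so the error of a truncation is uniform in x.\<close>

lemma tendsto_unitaries_of_basis:
  fixes A :: "'b \<Rightarrow> 'h::chilbert_space \<Rightarrow>\<^sub>L 'h"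
  assumes h: "orthonormal_basis h UNIV" and A: "\<And>x. A x \<in> unitaries" and B: "B \<in> unitaries"
    and lim: "\<And>n. ((\<lambda>x. blinfun_apply (A x) (h n)) \<longlongrightarrow> blinfun_apply B (h n)) F"
  shows "((\<lambda>x. blinfun_apply (A x) v) \<longlongrightarrow> blinfun_apply B v) F"
proof (rule tendstoI)
  fix \<epsilon> :: real assume \<epsilon>: "\<epsilon> > 0"
  obtain N where N: "dist (\<Sum>i<N. cinner v (h i) *\<^sub>C h i) v < \<epsilon> / 3"
    using parseval_tendsto[OF h closed_subspace_UNIV, of v, THEN tendstoD, of "\<epsilon> / 3"] \<epsilon>
    by (auto simp: eventually_sequentially)
  define w where "w = (\<Sum>i<N. cinner v (h i) *\<^sub>C h i)"
  have Ew: "blinfun_apply E w = (\<Sum>i<N. cinner v (h i) *\<^sub>C blinfun_apply E (h i))" if "E \<in> unitaries" for E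
    by (simp add: w_def blinfun.sum_right unitariesD(1)[OF that])
  have "((\<lambda>x. blinfun_apply (A x) w) \<longlongrightarrow> blinfun_apply B w) F"
    unfolding Ew[OF A] Ew[OF B] by (intro tendsto_intros tendsto_scaleC lim)
  then have "\<forall>\<^sub>F x in F. dist (blinfun_apply (A x) w) (blinfun_apply B w) < \<epsilon> / 3"
    using \<epsilon> by (intro tendstoD) auto
  then show "\<forall>\<^sub>F x in F. dist (blinfun_apply (A x) v) (blinfun_apply B v) < \<epsilon>"
  proof eventually_elim
    case (elim x)
    have d: "dist (blinfun_apply E w) (blinfun_apply E v) < \<epsilon> / 3" if "E \<in> unitaries" for E
      using N by (simp add: dist_norm w_def[symmetric] unitary_norm[OF that] flip: blinfun.diff_right)
    show ?case
      using elim d[OF A[of x]] d[OF B] dist_triangle3[of "blinfun_apply (A x) v" "blinfun_apply B v" "blinfun_apply (A x) w"]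
        dist_triangle[of "blinfun_apply (A x) w" "blinfun_apply B v" "blinfun_apply B w"] by linarith
  qed
qed

section \<open>Continuous families of orthonormal bases\<close>

text \<open>The recursive calls below stand under a sum over j < n; this congruence rule passes j <
  n to the termination proof.\<close>

declare sum.cong [fundef_cong]

fun gram_schmidt :: "(nat \<Rightarrow> 'a::complex_inner) \<Rightarrow> nat \<Rightarrow> 'a" where
  "gram_schmidt t n =
    (let v = t n - (\<Sum>j<n. cinner (t n) (gram_schmidt t j) *\<^sub>C gram_schmidt t j)
     in complex_of_real (1 / norm v) *\<^sub>C v)"

declare gram_schmidt.simps [simp del]

text \<open>The vector before normalisation. Where it is 0, so is the output of
  \<open>gram_schmidt\<close>, since 1 / 0 = 0; orthonormality and continuity therefore assume it to
  be nonzero.\<close>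

definition gs_residual :: "(nat \<Rightarrow> 'a::complex_inner) \<Rightarrow> nat \<Rightarrow> 'a" where
  "gs_residual t n = t n - (\<Sum>j<n. cinner (t n) (gram_schmidt t j) *\<^sub>C gram_schmidt t j)"

lemma gram_schmidt_residual:
  "gram_schmidt t n = complex_of_real (1 / norm (gs_residual t n)) *\<^sub>C gs_residual t n"
  by (subst gram_schmidt.simps) (simp add: gs_residual_def Let_def)

lemma gram_schmidt_orthonormal:
  assumes nz: "\<And>n. gs_residual t n \<noteq> 0"
  shows "orthonormal (gram_schmidt t)"
proof -
  have 1: "cinner (gram_schmidt t n) (gram_schmidt t n) = 1" for n
    using nz[of n] by (simp add: gram_schmidt_residual cinner_simps cinner_self power2_eq_square norm_divide)
  have 0: "i < n \<Longrightarrow> cinner (gram_schmidt t n) (gram_schmidt t i) = 0" for n i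
  proof (induction n arbitrary: i rule: less_induct)
    case (less n)
    have sym: "cinner (gram_schmidt t j) (gram_schmidt t i) = (if j = i then 1 else 0)" if "j < n" for j
      using less.IH[of j i] less.IH[of i j] that less.prems 1 cinner_commute[of "gram_schmidt t j" "gram_schmidt t i"]
      by (cases j i rule: linorder_cases) auto
    have "(\<Sum>j<n. cinner (t n) (gram_schmidt t j) * cinner (gram_schmidt t j) (gram_schmidt t i))
      = (\<Sum>j<n. if j = i then cinner (t n) (gram_schmidt t i) else 0)"
      by (intro sum.cong refl) (auto simp: sym)
    then have "cinner (gs_residual t n) (gram_schmidt t i) = 0"
      using less.prems by (simp add: gs_residual_def cinner_diff_left cinner_sum_left cinner_scaleC_left)
    then show ?case by (simp add: gram_schmidt_residual[of t n] cinner_scaleC_left)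
  qed
  show ?thesis
    unfolding orthonormal_def
  proof (intro allI)
    fix i j
    show "cinner (gram_schmidt t i) (gram_schmidt t j) = (if i = j then 1 else 0)"
      using 0[of i j] 0[of j i] 1 cinner_commute[of "gram_schmidt t i" "gram_schmidt t j"]
      by (cases i j rule: linorder_cases) auto
  qed
qed

text \<open>\<open>t n\<close> is a combination of the outputs up to n. Hence the outputs are total
  whenever the inputs are.\<close>

lemma gram_schmidt_orthogonal_imp:
  assumes nz: "\<And>n. gs_residual t n \<noteq> 0" and "\<And>n. cinner v (gram_schmidt t n) = 0"
  shows "cinner v (t n) = 0"
proof -
  have "gs_residual t n = complex_of_real (norm (gs_residual t n)) *\<^sub>C gram_schmidt t n"
    using nz[of n] by (simp add: gram_schmidt_residual scaleC_scaleC)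
  then have "t n = complex_of_real (norm (gs_residual t n)) *\<^sub>C gram_schmidt t n
      + (\<Sum>j<n. cinner (t n) (gram_schmidt t j) *\<^sub>C gram_schmidt t j)"
    by (simp add: gs_residual_def diff_eq_eq)
  then have "cinner v (t n) = cinner v (complex_of_real (norm (gs_residual t n)) *\<^sub>C gram_schmidt t n
      + (\<Sum>j<n. cinner (t n) (gram_schmidt t j) *\<^sub>C gram_schmidt t j))" by simp
  then show ?thesis by (simp add: cinner_add_right cinner_sum_right cinner_scaleC_right assms(2))
qed

lemma gram_schmidt_orthogonal:
  assumes "\<And>i. i \<le> n \<Longrightarrow> cinner (t i) u = 0"
  shows "cinner (gram_schmidt t n) u = 0"
  using assms
proof (induction n rule: less_induct)
  case (less n)
  then have "cinner (gram_schmidt t j) u = 0" if "j < n" for j using that by auto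
  then show ?case
    using less.prems by (simp add: gram_schmidt_residual[of t n] gs_residual_def cinner_scaleC_left cinner_diff_left cinner_sum_left)
qed

text \<open>Pairing with \<open>m n\<close> kills the earlier inputs, hence the projection that is
  subtracted, but not \<open>t n\<close>.\<close>

lemma gs_residual_nonzero:
  assumes "\<And>n i. i < n \<Longrightarrow> cinner (t i) (m n) = 0" and "\<And>n. cinner (t n) (m n) \<noteq> 0"
  shows "gs_residual t n \<noteq> 0"
proof
  assume "gs_residual t n = 0"
  then have "cinner (gs_residual t n) (m n) = 0" by simp
  moreover have "cinner (gram_schmidt t j) (m n) = 0" if "j < n" for j
    using that assms(1) by (intro gram_schmidt_orthogonal) auto
  ultimately show False
    using assms(2)[of n] by (simp add: gs_residual_def cinner_diff_left cinner_sum_left cinner_scaleC_left)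
qed

text \<open>The module generated by the fields in G over the continuous functions on X. Its members
  may be discontinuous; what passes from the generators to all of them is continuity of their inner
  products.\<close>

inductive_set continuous_span :: "'b::topological_space set \<Rightarrow> ('b \<Rightarrow> 'a::complex_inner) set \<Rightarrow> ('b \<Rightarrow> 'a) set"
  for X and G where
  base: "v \<in> G \<Longrightarrow> v \<in> continuous_span X G"
| zero: "(\<lambda>_. 0) \<in> continuous_span X G"
| add: "v \<in> continuous_span X G \<Longrightarrow> w \<in> continuous_span X G \<Longrightarrow> (\<lambda>x. v x + w x) \<in> continuous_span X G"
| scale: "v \<in> continuous_span X G \<Longrightarrow> continuous_on X c \<Longrightarrow> (\<lambda>x. c x *\<^sub>C v x) \<in> continuous_span X G"

lemma continuous_span_sum:
  "(\<And>j. j \<in> J \<Longrightarrow> f j \<in> continuous_span X G) \<Longrightarrow> (\<lambda>x. \<Sum>j\<in>J. f j x) \<in> continuous_span X G"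
  by (induction J rule: infinite_finite_induct) (auto intro: continuous_span.zero continuous_span.add)

lemma continuous_span_diff:
  assumes "v \<in> continuous_span X G" "w \<in> continuous_span X G"
  shows "(\<lambda>x. v x - w x) \<in> continuous_span X G"
proof -
  have "(\<lambda>x. v x + (- 1) *\<^sub>C w x) \<in> continuous_span X G"
    by (intro continuous_span.add continuous_span.scale assms continuous_on_const)
  then show ?thesis by (simp add: complex_vector.scale_minus_left)
qed

lemma continuous_map_euclidean_add:
  "continuous_map Z euclidean f \<Longrightarrow> continuous_map Z euclidean g \<Longrightarrow>
    continuous_map Z euclidean (\<lambda>z. f z + (g z :: complex))"
  by (simp add: continuous_map_atin tendsto_add)

lemma continuous_map_euclidean_mult:
  "continuous_map Z euclidean f \<Longrightarrow> continuous_map Z euclidean g \<Longrightarrow>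
    continuous_map Z euclidean (\<lambda>z. f z * (g z :: complex))"
  by (simp add: continuous_map_atin tendsto_mult)

lemma continuous_map_euclidean_cnj:
  "continuous_map Z euclidean f \<Longrightarrow> continuous_map Z euclidean (\<lambda>z. cnj (f z))"
  by (simp add: continuous_map_atin tendsto_cnj)

text \<open>Sesquilinear extension from the generators, one argument at a time. It serves twice:
  with the identity operator it gives the Gram functions on X, and with the operators of a
  representation its matrix coefficients on a product.\<close>

lemma continuous_map_cinner_continuous_span:
  fixes A :: "'z \<Rightarrow> 'h::chilbert_space \<Rightarrow>\<^sub>L 'h"
  assumes p: "continuous_map Z (top_of_set X) p"
    and A: "\<And>z c v. z \<in> topspace Z \<Longrightarrow> blinfun_apply (A z) (c *\<^sub>C v) = c *\<^sub>C blinfun_apply (A z) v"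
    and gen: "\<And>v w. v \<in> G \<Longrightarrow> w \<in> G \<Longrightarrow>
      continuous_map Z euclidean (\<lambda>z. cinner (blinfun_apply (A z) (v (p z))) (w (p z)))"
    and v: "v \<in> continuous_span X G" and w: "w \<in> continuous_span X G"
  shows "continuous_map Z euclidean (\<lambda>z. cinner (blinfun_apply (A z) (v (p z))) (w (p z)))"
proof -
  have cp: "continuous_map Z euclidean (\<lambda>z. c (p z))" if "continuous_on X c" for c :: "_ \<Rightarrow> complex"
    using continuous_map_compose[OF p, of euclidean c] that by (simp add: o_def)
  have *: "continuous_map Z euclidean (\<lambda>z. cinner (blinfun_apply (A z) (v (p z))) (w (p z)))" if "v \<in> G" for v
    using w
  proof induction
    case (base w)
    then show ?case using gen that by blast
  next
    case (add w w')
    then show ?case by (simp add: cinner_add_right continuous_map_euclidean_add)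
  next
    case (scale w c)
    then show ?case
      by (simp add: cinner_scaleC_right continuous_map_euclidean_mult continuous_map_euclidean_cnj cp)
  qed simp
  show ?thesis
    using v
  proof induction
    case (base v)
    then show ?case by (rule *)
  next
    case (add v v')
    then show ?case by (simp add: blinfun.add_right cinner_add_left continuous_map_euclidean_add)
  next
    case (scale v c)
    have "continuous_map Z euclidean (\<lambda>z. c (p z) * cinner (blinfun_apply (A z) (v (p z))) (w (p z)))"
      by (intro continuous_map_euclidean_mult cp scale)
    then show ?case
      by (rule continuous_map_eq) (simp add: A cinner_scaleC_left)
  qed (simp add: blinfun.zero_right)
qed

lemma continuous_on_cinner_continuous_span:
  fixes G :: "('b::topological_space \<Rightarrow> 'h::chilbert_space) set"
  assumes gen: "\<And>v w. v \<in> G \<Longrightarrow> w \<in> G \<Longrightarrow> continuous_on X (\<lambda>x. cinner (v x) (w x))"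
    and "v \<in> continuous_span X G" "w \<in> continuous_span X G"
  shows "continuous_on X (\<lambda>x. cinner (v x) (w x))"
  using continuous_map_cinner_continuous_span[of "top_of_set X" X "\<lambda>x. x" "\<lambda>_. id_blinfun" G v w] assms by simp

text \<open>Every coefficient in the recursion is an inner product of members of the module or the
  reciprocal of a norm, hence continuous. The construction thus never leaves the module.\<close>

lemma gram_schmidt_continuous_span:
  fixes G :: "('b::topological_space \<Rightarrow> 'h::chilbert_space) set"
  assumes gen: "\<And>v w. v \<in> G \<Longrightarrow> w \<in> G \<Longrightarrow> continuous_on X (\<lambda>x. cinner (v x) (w x))"
    and t: "\<And>n. (\<lambda>x. t x n) \<in> continuous_span X G"
    and nz: "\<And>n x. x \<in> X \<Longrightarrow> gs_residual (t x) n \<noteq> 0"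
  shows "(\<lambda>x. gram_schmidt (t x) n) \<in> continuous_span X G"
proof (induction n rule: less_induct)
  case (less n)
  note cc = continuous_on_cinner_continuous_span[of G X, OF gen]
  have r: "(\<lambda>x. gs_residual (t x) n) \<in> continuous_span X G"
    unfolding gs_residual_def
    by (intro continuous_span_diff continuous_span_sum continuous_span.scale t cc less) auto
  have "continuous_on X (\<lambda>x. norm (gs_residual (t x) n))"
    unfolding norm_eq_sqrt_cinner by (intro continuous_intros cc r)
  then have "continuous_on X (\<lambda>x. complex_of_real (1 / norm (gs_residual (t x) n)))"
    using nz by (intro continuous_on_of_real continuous_on_divide continuous_on_const) auto
  from continuous_span.scale[OF r this] show ?case
    unfolding gram_schmidt_residual[of "t _" n] .
qed

lemma continuous_map_euclidean_iff_tendsto: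
  "continuous_map Z euclidean f \<longleftrightarrow> (\<forall>p\<in>topspace Z. (f \<longlongrightarrow> f p) (atin Z p))"
  by (simp add: continuous_map_atin)

text \<open>U x carries H to the field with Gram matrix 1 - x x*. The orthonormal basis turned by U x into
  the fixed basis h comes from the vectors t x n; each y x i is a limit of such vectors and the m n
  make them independent, even though the y x i are dependent when x has norm 1.\<close>

lemma exists_unitary_family:
  fixes H :: "'h::chilbert_space set" and \<alpha> :: "'g \<Rightarrow> 'h \<Rightarrow>\<^sub>L 'h"
  assumes sep: "separable_space (euclidean :: 'h topology)"
    and inf: "infinite_dimensional (UNIV :: 'h set)"
    and H: "closed_subspace H" "infinite_dimensional H"
    and H': "infinite_dimensional (orthogonal_complement H)"
    and \<alpha>: "\<And>g. g \<in> topspace T \<Longrightarrow> \<alpha> g \<in> unitaries"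
    and \<alpha>_cont: "\<And>v. continuous_map T euclidean (\<lambda>g. blinfun_apply (\<alpha> g) v)"
    and \<alpha>_fix: "\<And>g u. g \<in> topspace T \<Longrightarrow> u \<in> H \<Longrightarrow> blinfun_apply (\<alpha> g) u = u"
  shows "\<exists>U z. (\<forall>x. U x \<in> unitaries) \<and> (\<forall>i. continuous_on l2_ball (z i)) \<and>
    (\<forall>x\<in>l2_ball. \<forall>i j. cinner (z i x) (z j x) = (if i = j then 1 else 0) - cnj (x i) * x j) \<and>
    (\<forall>x\<in>l2_ball. \<forall>w\<in>H. blinfun_apply (U x) w \<in> closure (complex_vector.span (range (\<lambda>i. z i x)))) \<and>
    (\<forall>v. continuous_map (prod_topology (top_of_set l2_ball) T) euclidean
      (\<lambda>(x, g). blinfun_apply (U x) (blinfun_apply (\<alpha> g) (blinfun_apply (inv\<^bsub>unitary_group\<^esub> (U x)) v))))"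
proof -
  obtain h :: "nat \<Rightarrow> 'h" where h: "orthonormal_basis h UNIV"
    using exists_orthonormal_basis[OF sep closed_subspace_UNIV inf] by blast
  obtain k where k: "orthonormal_basis k H" using exists_orthonormal_basis[OF sep H] by blast
  obtain m where m: "orthonormal_basis m (orthogonal_complement H)"
    using exists_orthonormal_basis[OF sep closed_subspace_orthogonal_complement H'] by blast
  note ho = orthonormal_basisD(1)[OF h] and mo = orthonormal_basisD(1)[OF m]
  have "\<forall>x\<in>l2_ball. \<exists>y. range y \<subseteq> H \<and>
    (\<forall>i j. cinner (y i) (y j) = (if i = j then 1 else 0) - cnj (x i) * x j) \<and>
    H \<subseteq> closure (complex_vector.span (range y))"
    by (intro ballI exists_family_with_gram_matrix[OF sep H(1) k]) (simp add: l2_ball_def)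
  \<comment> \<open>A separate choice at each x: nothing but the Gram matrix of \<open>y x\<close>
    is known to vary continuously.\<close>
  from bchoice[OF this] obtain y where ex: "\<forall>x\<in>l2_ball. range (y x) \<subseteq> H \<and>
    (\<forall>i j. cinner (y x i) (y x j) = (if i = j then 1 else 0) - cnj (x i) * x j) \<and>
    H \<subseteq> closure (complex_vector.span (range (y x)))" ..
  have y: "y x i \<in> H" "cinner (y x i) (y x j) = (if i = j then 1 else 0) - cnj (x i) * x j"
      "H \<subseteq> closure (complex_vector.span (range (y x)))" if "x \<in> l2_ball" for x i j
    using ex that by (simp_all add: image_subset_iff)
  have mH: "cinner (m n) u = 0" "cinner u (m n) = 0" if "u \<in> H" for n u
    using orthonormal_basisD(2)[OF m, of n] that cinner_commute[of u "m n"]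
    by (auto simp: orthogonal_complement_def)
  \<comment> \<open>Through \<open>prod_decode\<close> each index i occurs for infinitely many n, so
    \<open>y x i\<close> is perturbed by arbitrarily small multiples of pairwise different
    \<open>m n\<close>.\<close>
  define t where "t x n = y x (fst (prod_decode n)) + (1 / 2 ^ n) *\<^sub>C m n" for x n
  define G where "G = range (\<lambda>i x. y x i) \<union> range (\<lambda>n (x :: nat \<Rightarrow> complex). m n)"
  let ?Z = "prod_topology (top_of_set l2_ball) T"
  have cfst: "continuous_map ?Z (top_of_set l2_ball) fst" by (rule continuous_map_fst)
  have gram_cont: "continuous_on l2_ball (\<lambda>x. (if i = j then 1 else 0) - cnj (x i) * x j)" for i j :: nat
    by (intro continuous_intros continuous_on_subset[OF continuous_on_product_coordinates]) auto
  have genX: "continuous_on l2_ball (\<lambda>x. cinner (v x) (w x))" if "v \<in> G" "w \<in> G" for v w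
  proof -
    have 1: "continuous_on l2_ball (\<lambda>x. cinner (y x i) (y x j))" for i j
      using gram_cont[of i j] by (rule continuous_on_eq) (simp add: y(2))
    have 2: "continuous_on l2_ball (\<lambda>x. cinner (y x i) (m j))" "continuous_on l2_ball (\<lambda>x. cinner (m j) (y x i))" for i j
      using continuous_on_const[of l2_ball 0] by (rule continuous_on_eq, simp add: mH y(1))+
    show ?thesis using that unfolding G_def by (auto intro: 1 2)
  qed
  \<comment> \<open>Here \<alpha> does not see the choice of y. It fixes H, so two fields y give
    their Gram function; it preserves the complement of H, so the mixed terms are 0; and the terms
    between the \<open>m j\<close> depend on the group element alone.\<close>
  have genZ: "continuous_map ?Z euclidean (\<lambda>p. cinner (blinfun_apply (\<alpha> (snd p)) (v (fst p))) (w (fst p)))"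
    if "v \<in> G" "w \<in> G" for v w
  proof -
    have 1: "continuous_map ?Z euclidean (\<lambda>p. cinner (blinfun_apply (\<alpha> (snd p)) (y (fst p) i)) (y (fst p) j))" for i j
    proof (rule continuous_map_eq)
      show "continuous_map ?Z euclidean (\<lambda>p. (if i = j then 1 else 0) - cnj (fst p i) * fst p j)"
        using continuous_map_compose[OF cfst, of euclidean] gram_cont[of i j] by (fastforce simp: o_def)
    qed (auto simp: \<alpha>_fix y)
    have 2: "continuous_map ?Z euclidean (\<lambda>p. cinner (blinfun_apply (\<alpha> (snd p)) (y (fst p) i)) (m j))" for i j
      by (rule continuous_map_eq[of _ _ "\<lambda>_. 0"]) (auto simp: \<alpha>_fix y mH)
    have 3: "continuous_map ?Z euclidean (\<lambda>p. cinner (blinfun_apply (\<alpha> (snd p)) (m j)) (y (fst p) i))" for i j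
    proof (rule continuous_map_eq[of _ _ "\<lambda>_. 0"])
      fix p assume "p \<in> topspace ?Z"
      then have p: "fst p \<in> l2_ball" "snd p \<in> topspace T" by auto
      show "0 = cinner (blinfun_apply (\<alpha> (snd p)) (m j)) (y (fst p) i)"
        using unitariesD(2)[OF \<alpha>[OF p(2)], of "m j" "y (fst p) i"] \<alpha>_fix[OF p(2) y(1)[OF p(1)]] mH(1)[OF y(1)[OF p(1)]]
        by simp
    qed simp
    have 4: "continuous_map ?Z euclidean (\<lambda>p. cinner (blinfun_apply (\<alpha> (snd p)) (m i)) (m j))" for i j
    proof -
      have "continuous_map T euclidean (\<lambda>g. cinner (blinfun_apply (\<alpha> g) (m i)) (m j))"
        using \<alpha>_cont[of "m i"] unfolding continuous_map_euclidean_iff_tendsto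
        by (intro ballI tendsto_cinner tendsto_const) blast
      from continuous_map_compose[OF continuous_map_snd this] show ?thesis by (simp add: o_def)
    qed
    show ?thesis using that unfolding G_def by (auto intro: 1 2 3 4)
  qed
  have nz: "gs_residual (t x) n \<noteq> 0" if x: "x \<in> l2_ball" for x n
  proof (rule gs_residual_nonzero[where m = m])
    show "cinner (t x i) (m n) = 0" if "i < n" for i n
      using that by (simp add: t_def cinner_add_left cinner_scaleC_left mH y(1)[OF x] orthonormalD[OF mo])
    show "cinner (t x n) (m n) \<noteq> 0" for n
      by (simp add: t_def cinner_add_left cinner_scaleC_left mH y(1)[OF x] orthonormalD[OF mo])
  qed
  define c where "c x n = gram_schmidt (t x) n" for x n
  have c_span: "(\<lambda>x. c x n) \<in> continuous_span l2_ball G" for n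
    unfolding c_def
  proof (rule gram_schmidt_continuous_span[OF genX _ nz])
    show "(\<lambda>x. t x n) \<in> continuous_span l2_ball G" for n
      unfolding t_def by (intro continuous_span.add continuous_span.scale continuous_on_const continuous_span.base)
        (auto simp: G_def)
  qed
  have c_basis: "orthonormal_basis (c x) UNIV" if x: "x \<in> l2_ball" for x
    unfolding orthonormal_basis_def
  proof (intro conjI ballI impI)
    show "orthonormal (c x)" unfolding c_def by (rule gram_schmidt_orthonormal[OF nz[OF x]])
    fix v assume v: "\<forall>i. cinner v (c x i) = 0"
    have vt: "cinner v (t x n) = 0" for n
      by (rule gram_schmidt_orthogonal_imp[OF nz[OF x]]) (use v in \<open>simp add: c_def\<close>)
    \<comment> \<open>For n = \<open>prod_encode (i, j)\<close>, orthogonality to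
      \<open>t x n\<close> bounds this inner product by 2^-n times the norm of v. As n is at least
      j, let j tend to infinity.\<close>
    have vy: "cinner v (y x i) = 0" for i
    proof -
      have "cmod (cinner v (y x i)) \<le> (1 / 2) ^ j * norm v" for j
      proof -
        define n where "n = prod_encode (i, j)"
        have "cinner v (y x i) = - (cnj (1 / 2 ^ n) * cinner v (m n))"
          using vt[of n] by (simp add: t_def n_def cinner_add_right cinner_scaleC_right eq_neg_iff_add_eq_0)
        then have "cmod (cinner v (y x i)) = (1 / 2) ^ n * cmod (cinner v (m n))"
          by (simp add: norm_mult norm_divide norm_power power_divide)
        also have "\<dots> \<le> (1 / 2) ^ n * norm v"
          using cauchy_schwarz[of v "m n"] orthonormal_norm[OF mo, of n] by simp
        also have "\<dots> \<le> (1 / 2) ^ j * norm v"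
          using le_prod_encode_2[of j i] by (intro mult_right_mono power_decreasing) (auto simp: n_def)
        finally show ?thesis .
      qed
      moreover have "(\<lambda>j. (1 / 2) ^ j * norm v) \<longlonglongrightarrow> 0 * norm v"
        by (intro tendsto_intros LIMSEQ_power_zero) simp
      ultimately have "cmod (cinner v (y x i)) \<le> 0"
        by (intro LIMSEQ_le_const[where X = "\<lambda>j. (1 / 2) ^ j * norm v"]) auto
      then show ?thesis by simp
    qed
    have vm: "cinner v (m n) = 0" for n
      using vt[of n] by (simp add: t_def vy cinner_add_right cinner_scaleC_right)
    have "closure (complex_vector.span (range (y x))) \<subseteq> orthogonal_complement {v}"
    proof (intro closure_minimal complex_vector.span_minimal)
      show "range (y x) \<subseteq> orthogonal_complement {v}"
        using vy cinner_commute[of _ v] by (auto simp: orthogonal_complement_def)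
    qed (use closed_subspace_orthogonal_complement[of "{v}"] in \<open>auto simp: closed_subspace_def\<close>)
    then have "v \<in> orthogonal_complement H"
      using y(3)[OF x] cinner_commute[of v] by (fastforce simp: orthogonal_complement_def)
    then show "v = 0" using orthonormal_basisD(3)[OF m] vm by blast
  qed simp
  \<comment> \<open>Outside \<open>l2_ball\<close> any unitary serves as \<open>U x\<close>, so that
    unitarity holds without a condition on x.\<close>
  have "id_blinfun \<in> (unitaries :: ('h \<Rightarrow>\<^sub>L 'h) set)" by (auto simp: unitaries_def)
  then have "\<exists>F\<in>unitaries. x \<in> l2_ball \<longrightarrow> blinfun_apply F = basis_map (c x) h" for x
    using basis_map_unitary[OF c_basis[of x] h] by blast
  then obtain U where U: "\<And>x. U x \<in> unitaries" and Uc: "\<And>x. x \<in> l2_ball \<Longrightarrow> blinfun_apply (U x) = basis_map (c x) h"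
    by metis
  have coord: "cinner (blinfun_apply (U x) v) (h n) = cinner v (c x n)" if "x \<in> l2_ball" for x v n
    unfolding Uc[OF that] by (rule cinner_basis_map[OF orthonormal_basisD(1)[OF c_basis[OF that]] ho])
  have U_inv: "blinfun_apply (inv\<^bsub>unitary_group\<^esub> (U x)) (h n) = c x n" if x: "x \<in> l2_ball" for x n
  proof -
    have "blinfun_apply (U x) (c x n) - h n = 0"
      by (rule orthonormal_basisD(3)[OF h])
        (simp_all add: cinner_diff_left coord[OF x] orthonormalD[OF ho] orthonormalD[OF orthonormal_basisD(1)[OF c_basis[OF x]]])
    then show ?thesis using unitary_inv(2)[OF U, of x "c x n"] by simp
  qed
  \<comment> \<open>The coordinates of \<open>z i x\<close> in the fixed basis \<open>h\<close> are
    the inner products of \<open>y x i\<close> with \<open>c x n\<close>, and its norm is that of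
    \<open>y x i\<close>. Both are continuous, although neither y nor U need be.\<close>
  define z where "z i x = blinfun_apply (U x) (y x i)" for i x
  have "continuous_on l2_ball (z i)" for i
  proof -
    have yi: "(\<lambda>x. y x i) \<in> continuous_span l2_ball G" by (rule continuous_span.base) (auto simp: G_def)
    have cc: "continuous_on l2_ball (\<lambda>x. cinner (v x) (w x))"
      if "v \<in> continuous_span l2_ball G" "w \<in> continuous_span l2_ball G" for v w
      by (rule continuous_on_cinner_continuous_span[OF _ that]) (rule genX)
    have "continuous_on l2_ball (\<lambda>x. cinner (z i x) (h n))" for n
      using cc[OF yi c_span[of n]] by (rule continuous_on_eq) (simp add: z_def coord)
    moreover have "continuous_on l2_ball (\<lambda>x. norm (z i x))"
      unfolding z_def unitary_norm[OF U] unfolding norm_eq_sqrt_cinner by (intro continuous_intros cc yi)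
    ultimately show ?thesis
      unfolding continuous_on_def by (intro ballI tendsto_of_coordinates[OF h]) blast+
  qed
  moreover have "cinner (z i x) (z j x) = (if i = j then 1 else 0) - cnj (x i) * x j" if "x \<in> l2_ball" for i j x
    unfolding z_def unitariesD(2)[OF U] by (rule y(2)[OF that])
  moreover have "blinfun_apply (U x) w \<in> closure (complex_vector.span (range (\<lambda>i. z i x)))"
    if x: "x \<in> l2_ball" and w: "w \<in> H" for x w
  proof -
    have "w \<in> closure (complex_vector.span (range (y x)))" using y(3)[OF x] w by blast
    then obtain f where f: "\<And>n. f n \<in> complex_vector.span (range (y x))" "f \<longlonglongrightarrow> w"
      unfolding closure_sequential by blast
    have "blinfun_apply (U x) (f n) \<in> complex_vector.span (range (\<lambda>i. z i x))" for n
    proof -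
      have "blinfun_apply (U x) ` range (y x) = range (\<lambda>i. z i x)" by (auto simp: z_def)
      then show ?thesis
        using basis_map_span[OF orthonormal_basisD(1)[OF c_basis[OF x]] ho f(1)] unfolding Uc[OF x] by metis
    qed
    moreover have "(\<lambda>n. blinfun_apply (U x) (f n)) \<longlonglongrightarrow> blinfun_apply (U x) w"
      by (intro tendsto_intros f)
    ultimately show ?thesis
      unfolding closure_sequential by (intro exI[of _ "\<lambda>n. blinfun_apply (U x) (f n)"]) simp
  qed
  moreover have "continuous_map ?Z euclidean
      (\<lambda>(x, g). blinfun_apply (U x) (blinfun_apply (\<alpha> g) (blinfun_apply (inv\<^bsub>unitary_group\<^esub> (U x)) v)))" for v
  proof -
    \<comment> \<open>Completed by the identity outside the product space, because
      \<open>tendsto_unitaries_of_basis\<close> asks for a unitary at every point.\<close>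
    define A where "A p = (if p \<in> topspace ?Z
      then U (fst p) o\<^sub>L \<alpha> (snd p) o\<^sub>L inv\<^bsub>unitary_group\<^esub> (U (fst p)) else id_blinfun)" for p
    have A: "A p \<in> unitaries" for p
      unfolding A_def using \<open>id_blinfun \<in> unitaries\<close>
      by (auto intro!: unitaries_compose U \<alpha> unitary_inv)
    \<comment> \<open>The matrix of \<open>A p\<close> in the fixed basis \<open>h\<close> is that
      of \<alpha> in the moving basis \<open>c\<close>, whose members lie in the module.\<close>
    have "continuous_map ?Z euclidean (\<lambda>p. cinner (blinfun_apply (A p) (h i)) (h j))" for i j
    proof (rule continuous_map_eq)
      show "continuous_map ?Z euclidean (\<lambda>p. cinner (blinfun_apply (\<alpha> (snd p)) (c (fst p) i)) (c (fst p) j))"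
        by (rule continuous_map_cinner_continuous_span[OF cfst _ genZ c_span c_span])
          (auto intro: unitariesD(1)[OF \<alpha>])
    qed (auto simp: A_def coord U_inv)
    then have lim: "((\<lambda>q. blinfun_apply (A q) (h i)) \<longlongrightarrow> blinfun_apply (A p) (h i)) (atin ?Z p)"
      if "p \<in> topspace ?Z" for p i
      using that unfolding continuous_map_euclidean_iff_tendsto
      by (intro tendsto_of_coordinates[OF h]) (blast, simp add: unitary_norm[OF A])
    have "((\<lambda>q. blinfun_apply (A q) v) \<longlongrightarrow> blinfun_apply (A p) v) (atin ?Z p)"
      if "p \<in> topspace ?Z" for p
      by (rule tendsto_unitaries_of_basis[OF h A A lim[OF that]])
    then have "continuous_map ?Z euclidean (\<lambda>p. blinfun_apply (A p) v)"
      unfolding continuous_map_euclidean_iff_tendsto by (rule ballI)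
    then show ?thesis by (rule continuous_map_eq) (auto simp: A_def)
  qed
  ultimately show ?thesis using U by (intro exI[of _ U] exI[of _ z]) blast
qed

section \<open>Conjugates and fixed vectors of unitary representations\<close>

lemma infinite_dimensional_mono: "infinite_dimensional A \<Longrightarrow> A \<subseteq> B \<Longrightarrow> infinite_dimensional B"
  unfolding infinite_dimensional_def by blast

lemma unitary_span:
  assumes F: "F \<in> unitaries" and v: "v \<in> complex_vector.span B"
  shows "blinfun_apply F v \<in> complex_vector.span (blinfun_apply F ` B)"
  using v
proof (induction rule: complex_vector.span_induct_alt)
  case base
  show ?case by (simp add: blinfun.zero_right complex_vector.span_zero)
next
  case (step c x y)
  then show ?case
    unfolding blinfun.add_right unitariesD(1)[OF F]
    by (intro complex_vector.span_add complex_vector.span_scale) (auto intro: complex_vector.span_base)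
qed

lemma unitary_group_mult: "F \<otimes>\<^bsub>unitary_group\<^esub> E = F o\<^sub>L E"
  by (simp add: unitary_group_def)

lemma conjugation_apply:
  "g \<in> carrier G \<Longrightarrow> blinfun_apply (conjugation G \<alpha> F g) x =
    blinfun_apply F (blinfun_apply (\<alpha> g) (blinfun_apply (inv\<^bsub>unitary_group\<^esub> F) x))"
  by (simp add: conjugation_def unitary_group_mult)

lemma hom_st_isotypical:
  assumes "\<alpha> \<in> hom_st G T \<C>" "is_irrep G T V"
  shows "irrep_class G T V \<in> \<C> \<Longrightarrow> infinite_dimensional (isotypical G V \<alpha>)"
    and "irrep_class G T V \<notin> \<C> \<Longrightarrow> isotypical G V \<alpha> = {0}"
  using assms unfolding hom_st_def by (smt (verit) mem_Collect_eq)+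

text \<open>Composition with E turns homomorphisms into the representation \<beta> into
  homomorphisms into \<alpha>.\<close>

lemma unitary_intertwiner_isotypical:
  assumes E: "E \<in> unitaries"
    and tw: "\<And>g x. g \<in> carrier G \<Longrightarrow> blinfun_apply E (blinfun_apply (\<beta> g) x) = blinfun_apply (\<alpha> g) (blinfun_apply E x)"
    and x: "x \<in> isotypical G V \<beta>"
  shows "blinfun_apply E x \<in> isotypical G V \<alpha>"
proof -
  let ?S = "\<lambda>\<alpha>. {f v | f v. f \<in> hom_G G V \<alpha> \<and> v \<in> carrier_vec (fst V)}"
  have "blinfun_apply E \<circ> f \<in> hom_G G V \<alpha>" if "f \<in> hom_G G V \<beta>" for f
    using that by (auto simp: hom_G_def blinfun.add_right unitariesD(1)[OF E] tw split: prod.splits)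
  then have "blinfun_apply E ` ?S \<beta> \<subseteq> ?S \<alpha>" by (fastforce simp: o_def)
  moreover have "blinfun_apply E x \<in> complex_vector.span (blinfun_apply E ` ?S \<beta>)"
    by (rule unitary_span[OF E]) (use x in \<open>simp add: isotypical_def\<close>)
  ultimately show ?thesis unfolding isotypical_def using complex_vector.span_mono by blast
qed

lemma hom_unitary_group:
  assumes "\<alpha> \<in> hom G unitary_group"
  shows "g \<in> carrier G \<Longrightarrow> \<alpha> g \<in> unitaries"
    and "g \<in> carrier G \<Longrightarrow> h \<in> carrier G \<Longrightarrow> \<alpha> (g \<otimes>\<^bsub>G\<^esub> h) = \<alpha> g o\<^sub>L \<alpha> h"
  using assms by (auto simp: hom_def unitary_group_def Pi_iff)

lemma continuous_map_unitary_topology: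
  "continuous_map Z unitary_topology f \<longleftrightarrow>
    (\<forall>v. continuous_map Z euclidean (\<lambda>z. blinfun_apply (f z) v)) \<and> (\<forall>z\<in>topspace Z. f z \<in> unitaries)"
  unfolding unitary_topology_def continuous_map_in_subtopology
    continuous_on_strong_operator_topo_iff_coordinatewise by (auto simp: Pi_iff image_subset_iff)

text \<open>F and its inverse intertwine \<alpha> and its conjugate, so they carry the isotypical
  components into each other. Being zero and having infinite dimension are therefore
  preserved.\<close>

lemma conjugation_hom_st:
  assumes G: "Group.group G" and T: "topspace T = carrier G" and F: "F \<in> unitaries" and \<alpha>: "\<alpha> \<in> hom_st G T \<C>"
  shows "conjugation G \<alpha> F \<in> hom_st G T \<C>"
proof -
  let ?\<beta> = "conjugation G \<alpha> F"
  let ?F' = "inv\<^bsub>unitary_group\<^esub> F"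
  note F' = unitary_inv[OF F]
  have hom: "\<alpha> \<in> hom G unitary_group" and cont: "continuous_map T unitary_topology \<alpha>"
    using \<alpha> by (auto simp: hom_st_def continuous_maps_def)
  have \<beta>: "?\<beta> g = F o\<^sub>L \<alpha> g o\<^sub>L ?F'" if "g \<in> carrier G" for g
    by (rule blinfun_eqI) (simp add: conjugation_apply[OF that])
  have un: "?\<beta> g \<in> unitaries" if "g \<in> carrier G" for g
    unfolding \<beta>[OF that] by (intro unitaries_compose F F' hom_unitary_group(1)[OF hom] that)
  have "continuous_map T euclidean (\<lambda>g. blinfun_apply (?\<beta> g) v)" for v
  proof (rule continuous_map_eq)
    have "continuous_map T euclidean (\<lambda>g. blinfun_apply (\<alpha> g) (blinfun_apply ?F' v))"
      using cont by (simp add: continuous_map_unitary_topology)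
    then show "continuous_map T euclidean (\<lambda>g. blinfun_apply F (blinfun_apply (\<alpha> g) (blinfun_apply ?F' v)))"
      unfolding continuous_map_euclidean_iff_tendsto 
      by (intro ballI blinfun.tendsto[OF tendsto_const]) blast
  qed (simp add: T conjugation_apply)
  then have "?\<beta> \<in> continuous_maps T unitary_topology"
    using un by (simp add: continuous_maps_def continuous_map_unitary_topology T conjugation_def)
  moreover have "?\<beta> \<in> hom G unitary_group"
  proof (rule homI)
    show "?\<beta> g \<in> carrier unitary_group" if "g \<in> carrier G" for g
      using un[OF that] by (simp add: unitary_group_def)
    fix g h assume gh: "g \<in> carrier G" "h \<in> carrier G"
    have "?\<beta> (g \<otimes>\<^bsub>G\<^esub> h) = ?\<beta> g o\<^sub>L ?\<beta> h"
      using group.is_monoid[OF G] gh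
      by (intro blinfun_eqI) (simp add: conjugation_apply F' monoid.m_closed hom_unitary_group(2)[OF hom])
    then show "?\<beta> (g \<otimes>\<^bsub>G\<^esub> h) = ?\<beta> g \<otimes>\<^bsub>unitary_group\<^esub> ?\<beta> h"
      by (simp add: unitary_group_def)
  qed
  moreover have "if irrep_class G T V \<in> \<C> then infinite_dimensional (isotypical G V ?\<beta>) else isotypical G V ?\<beta> = {0}"
    if V: "is_irrep G T V" for V
  proof -
    have to_\<alpha>: "blinfun_apply ?F' x \<in> isotypical G V \<alpha>" if "x \<in> isotypical G V ?\<beta>" for x
      by (rule unitary_intertwiner_isotypical[OF F'(1) _ that]) (simp add: conjugation_apply F')
    have from_\<alpha>: "blinfun_apply F x \<in> isotypical G V ?\<beta>" if "x \<in> isotypical G V \<alpha>" for x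
      by (rule unitary_intertwiner_isotypical[OF F _ that]) (simp add: conjugation_apply F')
    show ?thesis
    proof (cases "irrep_class G T V \<in> \<C>")
      case True
      then have inf: "infinite_dimensional (isotypical G V \<alpha>)" by (rule hom_st_isotypical(1)[OF \<alpha> V])
      have "infinite_dimensional (isotypical G V ?\<beta>)"
        unfolding infinite_dimensional_def
      proof
        assume "\<exists>B. finite B \<and> isotypical G V ?\<beta> \<subseteq> complex_vector.span B"
        then obtain B where B: "finite B" "isotypical G V ?\<beta> \<subseteq> complex_vector.span B" by blast
        have "isotypical G V \<alpha> \<subseteq> complex_vector.span (blinfun_apply ?F' ` B)"
        proof
          fix x assume "x \<in> isotypical G V \<alpha>"
          then have "blinfun_apply F x \<in> complex_vector.span B" using from_\<alpha> B(2) by blast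
          from unitary_span[OF F'(1) this] show "x \<in> complex_vector.span (blinfun_apply ?F' ` B)"
            by (simp add: F')
        qed
        then show False using inf B(1) unfolding infinite_dimensional_def by blast
      qed
      then show ?thesis using True by simp
    next
      case False
      then have "isotypical G V \<alpha> = {0}" by (rule hom_st_isotypical(2)[OF \<alpha> V])
      then have "x = 0" if "x \<in> isotypical G V ?\<beta>" for x
        using to_\<alpha>[OF that] F'(3)[of x] by (simp add: blinfun.zero_right)
      moreover have "0 \<in> isotypical G V ?\<beta>" by (simp add: isotypical_def complex_vector.span_zero)
      ultimately show ?thesis using False by auto
    qed
  qed
  ultimately show ?thesis by (simp add: hom_st_def)
qed

section \<open>Fixed vectors and the trivial representation\<close>

definition fixed_vectors :: "'g monoid \<Rightarrow> ('g \<Rightarrow> 'h::chilbert_space \<Rightarrow>\<^sub>L 'h) \<Rightarrow> 'h set" where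
  "fixed_vectors G \<alpha> = {v. \<forall>g\<in>carrier G. blinfun_apply (\<alpha> g) v = v}"

lemma closed_subspace_fixed_vectors:
  assumes "\<alpha> \<in> hom G unitary_group"
  shows "closed_subspace (fixed_vectors G \<alpha>)"
proof -
  have "fixed_vectors G \<alpha> = (\<Inter>g\<in>carrier G. {v. blinfun_apply (\<alpha> g) v = v})"
    by (auto simp: fixed_vectors_def)
  moreover have "closed {v. blinfun_apply (\<alpha> g) v = v}" for g
    by (intro closed_Collect_eq continuous_intros)
  ultimately have "closed (fixed_vectors G \<alpha>)" by auto
  then show ?thesis
    using unitariesD(1)[OF hom_unitary_group(1)[OF assms]]
    by (auto simp: closed_subspace_def complex_vector.subspace_def fixed_vectors_def blinfun.add_right blinfun.zero_right)
qed

lemma isotypical_trivial_fixed: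
  assumes "\<alpha> \<in> hom G unitary_group"
  shows "isotypical G trivial_rep \<alpha> \<subseteq> fixed_vectors G \<alpha>"
  unfolding isotypical_def
proof (rule complex_vector.span_minimal)
  show "{f v | f v. f \<in> hom_G G trivial_rep \<alpha> \<and> v \<in> carrier_vec (fst trivial_rep)} \<subseteq> fixed_vectors G \<alpha>"
    by (auto simp: hom_G_def trivial_rep_def fixed_vectors_def)
  show "complex_vector.subspace (fixed_vectors G \<alpha>)"
    using closed_subspace_fixed_vectors[OF assms] by (simp add: closed_subspace_def)
qed

lemma is_irrep_trivial: "is_irrep G T trivial_rep"
  unfolding is_irrep_def
proof (intro conjI allI impI)
  show "is_rep G T trivial_rep" by (auto simp: is_rep_def trivial_rep_def)
  show "fst (trivial_rep :: 'a matrix_rep) \<noteq> 0" by (simp add: trivial_rep_def)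
  fix W assume "invariant_subspace G trivial_rep W"
  then have W: "W \<subseteq> carrier_vec 1" "0\<^sub>v 1 \<in> W" "\<And>c v. v \<in> W \<Longrightarrow> c \<cdot>\<^sub>v v \<in> W"
    by (auto simp: invariant_subspace_def trivial_rep_def)
  show "W = {0\<^sub>v (fst (trivial_rep :: 'a matrix_rep))} \<or> W = carrier_vec (fst (trivial_rep :: 'a matrix_rep))"
  proof (cases "W = {0\<^sub>v 1}")
    case False
    then obtain v where v: "v \<in> W" "v \<noteq> 0\<^sub>v 1" using W(2) by blast
    then have dim: "v \<in> carrier_vec 1" using W(1) by blast
    then have v0: "v $ 0 \<noteq> 0" using v(2) by (auto simp: vec_eq_iff)
    have "w \<in> W" if w: "w \<in> carrier_vec 1" for w
    proof -
      have "w = (w $ 0 / v $ 0) \<cdot>\<^sub>v v" using w dim v0 by (auto simp: vec_eq_iff)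
      then show ?thesis using W(3)[OF v(1)] by metis
    qed
    then show ?thesis using W(1) by (auto simp: trivial_rep_def)
  qed (simp add: trivial_rep_def)
qed

text \<open>Schur's lemma in the only case needed: an invariant functional on a nontrivial irreducible
  representation vanishes.\<close>

lemma isotypical_nontrivial_orthogonal_fixed:
  assumes V: "is_irrep G T V" and nt: "irrep_class G T V \<noteq> irrep_class G T trivial_rep"
    and \<alpha>: "\<alpha> \<in> hom G unitary_group"
  shows "isotypical G V \<alpha> \<subseteq> orthogonal_complement (fixed_vectors G \<alpha>)"
  unfolding isotypical_def
proof (rule complex_vector.span_minimal)
  show "complex_vector.subspace (orthogonal_complement (fixed_vectors G \<alpha>))"
    using closed_subspace_orthogonal_complement by (auto simp: closed_subspace_def)
  obtain n \<rho> where Vn: "V = (n, \<rho>)" by (cases V)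
  have \<rho>: "\<rho> g \<in> carrier_mat n n" if "g \<in> carrier G" for g
    using V that by (auto simp: is_irrep_def is_rep_def Vn)
  have "cinner (f v) u = 0" if f: "f \<in> hom_G G V \<alpha>" and v: "v \<in> carrier_vec n" and u: "u \<in> fixed_vectors G \<alpha>" for f v u
  proof -
    have fadd: "f (v + w) = f v + f w" if "v \<in> carrier_vec n" "w \<in> carrier_vec n" for v w
      using f that by (auto simp: hom_G_def Vn)
    have fsc: "f (c \<cdot>\<^sub>v v) = c *\<^sub>C f v" if "v \<in> carrier_vec n" for v c
      using f that by (auto simp: hom_G_def Vn)
    have f\<rho>: "cinner (f (\<rho> g *\<^sub>v v)) u = cinner (f v) u" if "g \<in> carrier G" "v \<in> carrier_vec n" for g v
    proof -
      have "cinner (f (\<rho> g *\<^sub>v v)) u = cinner (blinfun_apply (\<alpha> g) (f v)) (blinfun_apply (\<alpha> g) u)"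
        using f u that by (auto simp: hom_G_def Vn fixed_vectors_def)
      then show ?thesis by (simp add: unitariesD(2)[OF hom_unitary_group(1)[OF \<alpha> that(1)]])
    qed
    \<comment> \<open>The kernel of the functional sending v to the inner product of
      \<open>f v\<close> with u. It is invariant because u is fixed, so it is everything, as wanted,
      or zero; the latter forces V to be trivial.\<close>
    define W where "W = {v \<in> carrier_vec n. cinner (f v) u = 0}"
    have "f (0\<^sub>v n) = 0" 
    proof -
      have "0 \<cdot>\<^sub>v 0\<^sub>v n = (0\<^sub>v n :: complex vec)" by (rule eq_vecI) auto
      then show ?thesis using fsc[of "0\<^sub>v n" 0] by simp
    qed
    then have "invariant_subspace G V W"
      using mult_mat_vec_carrier[OF \<rho>]
      by (auto simp: invariant_subspace_def Vn W_def fadd fsc f\<rho> cinner_simps)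
    then consider "W = {0\<^sub>v n}" | "W = carrier_vec n"
      using V by (auto simp: is_irrep_def Vn)
    then show ?thesis
    proof cases
      case 1
      then have W0: "w = 0\<^sub>v n" if "w \<in> carrier_vec n" "cinner (f w) u = 0" for w
        using that by (auto simp: W_def)
      have "n = 1"
      proof (rule ccontr)
        assume "n \<noteq> 1"
        moreover have "n \<noteq> 0" using V by (simp add: is_irrep_def Vn)
        ultimately have n: "n > 1" by simp
        \<comment> \<open>The combination of two basis vectors on which the functional
          cancels.\<close>
        let ?w = "cinner (f (unit_vec n 1)) u \<cdot>\<^sub>v unit_vec n 0 + (- cinner (f (unit_vec n 0)) u) \<cdot>\<^sub>v unit_vec n 1"
        have "?w = 0\<^sub>v n"
          by (rule W0) (auto simp: fadd fsc cinner_simps)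
        then have "?w $ 0 = 0\<^sub>v n $ 0" by simp
        then have "cinner (f (unit_vec n 1)) u = 0" using n by simp
        then have "unit_vec n 1 = (0\<^sub>v n :: complex vec)" by (intro W0) auto
        then have "unit_vec n 1 $ 1 = (0\<^sub>v n :: complex vec) $ 1" by simp
        then show False using n by simp
      qed
      \<comment> \<open>The functional takes the same value on the basis vector and on its image
        under \<open>\<rho> g\<close>, and it has zero kernel.\<close>
      have \<rho>1: "\<rho> g = 1\<^sub>m 1" if g: "g \<in> carrier G" for g
      proof -
        let ?e = "unit_vec 1 0 :: complex vec"
        have e: "?e \<in> carrier_vec n" "\<rho> g *\<^sub>v ?e \<in> carrier_vec n" using \<rho>[OF g] \<open>n = 1\<close> by auto
        have "\<rho> g *\<^sub>v ?e + (- 1) \<cdot>\<^sub>v ?e = 0\<^sub>v n"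
          by (rule W0) (use e g in \<open>auto simp: fadd fsc f\<rho> cinner_simps\<close>)
        then have "(\<rho> g *\<^sub>v ?e + (- 1) \<cdot>\<^sub>v ?e) $ 0 = 0" by (simp add: \<open>n = 1\<close>)
        then have "\<rho> g $$ (0, 0) = 1" using \<rho>[OF g] \<open>n = 1\<close> by (simp add: scalar_prod_def)
        then show ?thesis using \<rho>[OF g] \<open>n = 1\<close> by (intro eq_matI) auto
      qed
      \<comment> \<open>\<open>isomorphic_reps\<close> looks only at values on
        \<open>carrier G\<close>, where \<rho> now agrees with the trivial representation.\<close>
      have "isomorphic_reps G V W' \<longleftrightarrow> isomorphic_reps G trivial_rep W'" for W'
        using \<rho>1 by (auto simp: isomorphic_reps_def trivial_rep_def Vn \<open>n = 1\<close> split: prod.splits)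
      then have "irrep_class G T V = irrep_class G T trivial_rep"
        using V is_irrep_trivial by (auto simp: irrep_class_def irrep_iso_def)
      then show ?thesis using nt by simp
    next
      case 2
      then show ?thesis using v by (auto simp: W_def)
    qed
  qed
  then show "{f v | f v. f \<in> hom_G G V \<alpha> \<and> v \<in> carrier_vec (fst V)} \<subseteq> orthogonal_complement (fixed_vectors G \<alpha>)"
    by (auto simp: orthogonal_complement_def Vn)
qed

text \<open>If \<open>\<Phi> x\<close> maps a compact K into an open U, the tube lemma gives a
  neighbourhood of x on which this stays true. That is openness of the preimage of a subbasic
  set.\<close>

lemma continuous_map_curry_compact_open:
  assumes joint: "continuous_map (prod_topology Z T) Y (\<lambda>(x, g). \<Phi> x g)"
    and \<Phi>: "\<And>x. x \<in> topspace Z \<Longrightarrow> \<Phi> x \<in> continuous_maps T Y"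
  shows "continuous_map Z (compact_open_topology T Y) \<Phi>"
  unfolding compact_open_topology_def
proof (rule continuous_on_generated_topo)
  show "\<Phi> ` topspace Z \<subseteq> \<Union>{{f \<in> continuous_maps T Y. f ` K \<subseteq> U} |K U. compactin T K \<and> openin Y U}"
  proof
    fix f assume "f \<in> \<Phi> ` topspace Z"
    \<comment> \<open>Empty K and U make the set of all continuous maps subbasic, so the range of
      \<Phi> lies in the union of the subbasis.\<close>
    then have "f \<in> {f \<in> continuous_maps T Y. f ` {} \<subseteq> {}}" using \<Phi> by auto
    then show "f \<in> \<Union>{{f \<in> continuous_maps T Y. f ` K \<subseteq> U} |K U. compactin T K \<and> openin Y U}"
      by (intro UnionI[of "{f \<in> continuous_maps T Y. f ` {} \<subseteq> {}}"]) blast+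
  qed
  fix S assume "S \<in> {{f \<in> continuous_maps T Y. f ` K \<subseteq> U} |K U. compactin T K \<and> openin Y U}"
  then obtain K U where S: "S = {f \<in> continuous_maps T Y. f ` K \<subseteq> U}" and K: "compactin T K" and U: "openin Y U"
    by blast
  let ?W = "{p \<in> topspace (prod_topology Z T). (\<lambda>(x, g). \<Phi> x g) p \<in> U}"
  have W: "openin (prod_topology Z T) ?W" by (rule openin_continuous_map_preimage[OF joint U])
  have KT: "K \<subseteq> topspace T" using K by (rule compactin_subset_topspace)
  show "openin Z (\<Phi> -` S \<inter> topspace Z)"
  proof (subst openin_subopen, intro ballI)
    fix x assume "x \<in> \<Phi> -` S \<inter> topspace Z"
    then have x: "x \<in> topspace Z" "\<Phi> x ` K \<subseteq> U" by (auto simp: S)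
    then have "{x} \<times> K \<subseteq> ?W" using KT by auto
    then obtain A B where A: "openin Z A" "x \<in> A" "K \<subseteq> B" "A \<times> B \<subseteq> ?W"
      using tube_lemma_right[OF W K x(1)] by blast
    have "A \<subseteq> \<Phi> -` S \<inter> topspace Z"
    proof
      fix a assume a: "a \<in> A"
      then have aZ: "a \<in> topspace Z" using openin_subset[OF A(1)] by blast
      have "\<Phi> a g \<in> U" if "g \<in> K" for g
      proof -
        have "(a, g) \<in> ?W" using a A(3,4) that by blast
        then show ?thesis by simp
      qed
      then show "a \<in> \<Phi> -` S \<inter> topspace Z" using aZ \<Phi> by (auto simp: S)
    qed
    then show "\<exists>A. openin Z A \<and> x \<in> A \<and> A \<subseteq> \<Phi> -` S \<inter> topspace Z" using A(1,2) by blast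
  qed
qed

text \<open>The hypothesis \<open>nondegenerate\<close> excludes a true exception. If \<C> contains
  the trivial class only, then by the Peter-Weyl theorem \<alpha> is constantly the identity, the
  space of homomorphisms is a single point, and a section exists.\<close>

theorem theorem4p8:
  fixes G :: "'g monoid" and T :: "'g topology" and n :: nat and \<A> :: "'g chart set"
    and \<C> :: "'g matrix_rep set set" and \<alpha> :: "'g \<Rightarrow> 'h::chilbert_space \<Rightarrow>\<^sub>L 'h"
  assumes "lie_group G T n \<A>" and "compact_space T"
    and "separable_space (euclidean :: 'h topology)" and "infinite_dimensional (UNIV :: 'h set)"
    and "\<C> \<subseteq> Irrep G T"
    and "\<alpha> \<in> hom_st G T \<C>"
    and "irrep_class G T trivial_rep \<in> \<C>"
    and nondegenerate: "\<C> \<noteq> {irrep_class G T trivial_rep}"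
  shows "\<not> (\<exists>\<sigma>. continuous_map (hom_st_topology G T \<C>) unitary_topology \<sigma> \<and>
                (\<forall>\<beta>\<in>hom_st G T \<C>. conjugation G \<alpha> (\<sigma> \<beta>) = \<beta>))"
proof
  assume "\<exists>\<sigma>. continuous_map (hom_st_topology G T \<C>) unitary_topology \<sigma> \<and>
                (\<forall>\<beta>\<in>hom_st G T \<C>. conjugation G \<alpha> (\<sigma> \<beta>) = \<beta>)"
  then obtain \<sigma> where \<sigma>: "continuous_map (hom_st_topology G T \<C>) unitary_topology \<sigma>"
    and sec: "\<And>\<beta>. \<beta> \<in> hom_st G T \<C> \<Longrightarrow> conjugation G \<alpha> (\<sigma> \<beta>) = \<beta>" by blast
  have G: "Group.group G" and T: "topspace T = carrier G" using assms(1) by (simp_all add: lie_group_def)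
  have hom: "\<alpha> \<in> hom G unitary_group" and cont: "continuous_map T unitary_topology \<alpha>"
    using assms(6) by (auto simp: hom_st_def continuous_maps_def)
  define H where "H = fixed_vectors G \<alpha>"
  have H: "closed_subspace H" unfolding H_def by (rule closed_subspace_fixed_vectors[OF hom])
  have "infinite_dimensional (isotypical G trivial_rep \<alpha>)"
    by (rule hom_st_isotypical(1)[OF assms(6) is_irrep_trivial assms(7)])
  then have infH: "infinite_dimensional H"
    unfolding H_def using isotypical_trivial_fixed[OF hom] infinite_dimensional_mono by blast
  obtain c where c: "c \<in> \<C>" "c \<noteq> irrep_class G T trivial_rep" using nondegenerate assms(7) by blast
  then have "c \<in> {V. is_irrep G T V} // irrep_iso G T" using assms(5) by (auto simp: Irrep_def)
  then obtain V where V: "is_irrep G T V" "c = irrep_class G T V"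
    unfolding irrep_class_def by (rule quotientE) blast
  have "infinite_dimensional (isotypical G V \<alpha>)" using hom_st_isotypical(1)[OF assms(6) V(1)] V(2) c(1) by simp
  then have infH': "infinite_dimensional (orthogonal_complement H)"
    unfolding H_def using isotypical_nontrivial_orthogonal_fixed[OF V(1) _ hom] c(2) V(2) infinite_dimensional_mono by blast
  obtain k where k: "orthonormal_basis k H" using exists_orthonormal_basis[OF assms(3) H infH] by blast
  have \<alpha>_cont: "continuous_map T euclidean (\<lambda>g. blinfun_apply (\<alpha> g) v)" for v
    using cont by (simp add: continuous_map_unitary_topology)
  have \<alpha>_un: "\<alpha> g \<in> unitaries" if "g \<in> topspace T" for g
    using hom_unitary_group(1)[OF hom] that by (simp add: T)
  have \<alpha>_fix: "blinfun_apply (\<alpha> g) u = u" if "g \<in> topspace T" "u \<in> H" for g u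
    using that by (simp add: T H_def fixed_vectors_def)
  obtain U z where U: "\<And>x. U x \<in> unitaries" and z: "\<And>i. continuous_on l2_ball (z i)"
    and gram: "\<And>x i j. x \<in> l2_ball \<Longrightarrow> cinner (z i x) (z j x) = (if i = j then 1 else 0) - cnj (x i) * x j"
    and UH: "\<And>x w. x \<in> l2_ball \<Longrightarrow> w \<in> H \<Longrightarrow> blinfun_apply (U x) w \<in> closure (complex_vector.span (range (\<lambda>i. z i x)))"
    and joint: "\<And>v. continuous_map (prod_topology (top_of_set l2_ball) T) euclidean
      (\<lambda>(x, g). blinfun_apply (U x) (blinfun_apply (\<alpha> g) (blinfun_apply (inv\<^bsub>unitary_group\<^esub> (U x)) v)))"
    using exists_unitary_family[OF assms(3,4) H infH infH' \<alpha>_un \<alpha>_cont \<alpha>_fix] by blast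
  define \<Phi> where "\<Phi> x = conjugation G \<alpha> (U x)" for x
  have \<Phi>: "\<Phi> x \<in> hom_st G T \<C>" for x
    unfolding \<Phi>_def by (rule conjugation_hom_st[OF G T U assms(6)])
  have "continuous_map (top_of_set l2_ball) (compact_open_topology T unitary_topology) \<Phi>"
  proof (rule continuous_map_curry_compact_open)
    show "\<Phi> x \<in> continuous_maps T unitary_topology" for x using \<Phi>[of x] by (simp add: hom_st_def)
    show "continuous_map (prod_topology (top_of_set l2_ball) T) unitary_topology (\<lambda>(x, g). \<Phi> x g)"
      unfolding continuous_map_unitary_topology
    proof (intro conjI allI ballI)
      show "continuous_map (prod_topology (top_of_set l2_ball) T) euclidean (\<lambda>p. blinfun_apply (case p of (x, g) \<Rightarrow> \<Phi> x g) v)" for v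
        by (rule continuous_map_eq[OF joint[of v]]) (auto simp: \<Phi>_def T conjugation_apply)
      fix p assume "p \<in> topspace (prod_topology (top_of_set l2_ball) T)"
      moreover have "\<Phi> x \<in> hom G unitary_group" for x using \<Phi>[of x] by (simp add: hom_st_def)
      ultimately show "(case p of (x, g) \<Rightarrow> \<Phi> x g) \<in> unitaries"
        by (auto simp: T intro: hom_unitary_group(1))
    qed
  qed
  then have "continuous_map (top_of_set l2_ball) (hom_st_topology G T \<C>) \<Phi>"
    using \<Phi> by (simp add: hom_st_topology_def continuous_map_in_subtopology image_subset_iff Pi_iff)
  from continuous_map_compose[OF this \<sigma>]
  have c\<sigma>: "continuous_map (top_of_set l2_ball) unitary_topology (\<lambda>x. \<sigma> (\<Phi> x))" by (simp add: o_def)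
  define s where "s x = blinfun_apply (\<sigma> (\<Phi> x)) (k 0)" for x
  have "continuous_on l2_ball s"
    using c\<sigma> by (simp add: continuous_map_unitary_topology s_def)
  moreover have F: "\<sigma> (\<Phi> x) \<in> unitaries" if "x \<in> l2_ball" for x
    using c\<sigma> that by (simp add: continuous_map_unitary_topology)
  have "s x \<in> closure (complex_vector.span (range (\<lambda>i. z i x)))" if x: "x \<in> l2_ball" for x
  proof -
    \<comment> \<open>The unitaries \<open>U x\<close> and \<open>\<sigma> (\<Phi> x)\<close> may
      differ, but they conjugate \<alpha> to the same homomorphism. It fixes \<open>s x\<close>, as
      \<alpha> fixes \<open>k 0\<close>; pulling \<open>s x\<close> back by \<open>U x\<close> thus
      gives a vector fixed by \<alpha>.\<close>
    define w where "w = blinfun_apply (inv\<^bsub>unitary_group\<^esub> (U x)) (s x)"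
    have "blinfun_apply (\<alpha> g) w = w" if g: "g \<in> carrier G" for g
    proof -
      have "blinfun_apply (U x) (blinfun_apply (\<alpha> g) w) = blinfun_apply (conjugation G \<alpha> (\<sigma> (\<Phi> x)) g) (s x)"
        unfolding sec[OF \<Phi>] by (simp add: \<Phi>_def conjugation_apply[OF g] w_def)
      also have "\<dots> = s x"
        using orthonormal_basisD(2)[OF k, of 0] g
        by (simp add: conjugation_apply[OF g] s_def unitary_inv(2)[OF F[OF x]] \<alpha>_fix T)
      finally show ?thesis using unitary_inv(2)[OF U, of x "blinfun_apply (\<alpha> g) w"] by (simp add: w_def)
    qed
    then have "w \<in> H" by (simp add: H_def fixed_vectors_def)
    from UH[OF x this] show ?thesis by (simp add: w_def unitary_inv(3)[OF U])
  qed
  ultimately obtain x where x: "x \<in> l2_ball" "s x = 0" using section_vanishes[OF z gram] by blast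
  then have "norm (k 0) = 0" using unitary_norm[OF F[OF x(1)], of "k 0"] by (simp add: s_def)
  then show False using orthonormal_norm[OF orthonormal_basisD(1)[OF k]] by simp
qed

end
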